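(* Assume that for every $i\in\mathcal I$ the Slater condition holds: there exists $Z_i\in\mathbb R^{(n+m)\times n}$ such that $$\begin{bmatrix} I & Z_i^\top\end{bmatrix} H_i \begin{bmatrix} I & Z_i^\top\end{bmatrix}^\top\succ 0 .$$ Let $P_i\succ 0$ ($n\times n$) and $K_i\in\mathbb R^{m\times n}$ for $i\in\mathcal I$, $\Pi=[\pi_{i,j}]\in\mathcal M_+$, and $Q\succ 0$ ($n\times n$). Then $$(A_i+B_iK_i)^\top P_i+P_i(A_i+B_iK_i)+\sum_{j\in\mathcal I}\pi_{j,i}P_j+Q\preccurlyeq 0\qquad \forall i\in\mathcal I,\ \forall (A_i,B_i)\in\mathcal C_i$$ if and only if there exist scalars $\alpha_i\ge 0$, $i\in\mathcal I$, such that, with $L_i:=K_iP_i^{-1}$, for all $i\in\mathcal I$, $$\begin{bmatrix} Q^{-1} & 0 & P_i^{-1} & 0 & 0 \\ 0 & \boldsymbol\pi_{-i}^{-1}\boldsymbol P_{-i}^{-1} & (\mathbf 1_{N-1}\otimes I_n)P_i^{-1} & 0 & 0 \\ P_i^{-1} & P_i^{-1}(\mathbf 1_{N-1}\otimes I_n)^\top & -\pi_{i,i}P_i^{-1} & -P_i^{-1} & -L_i^\top \\ 0&0&-P_i^{-1}&0&0 \\ 0&0&-L_i&0&0\end{bmatrix}-\alpha_i\,\Gamma_i\,\Phi^i\,\Gamma_i^\top\succcurlyeq 0,\qquad \Gamma_i:=\begin{bmatrix} 0&0 \\ 0&0 \\ I&\dot X_i \\ 0&-X_i \\ 0&-U_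i\end{bmatrix}.$$
   Context: Let $\mathcal I=\{1,\dots,N\}$. For each $i\in\mathcal I$, true (unknown) matrices $\bar A_i\in\mathbb R^{n\times n}$, $\bar B_i\in\mathbb R^{n\times m}$ are given, together with data matrices $X_i,\dot X_i\in\mathbb R^{n\times T_i}$, $U_i\in\mathbb R^{m\times T_i}$ (here $\dot X_i$ is just a name) satisfying $\dot X_i=\bar A_iX_i+\bar B_iU_i+\bar W_i$ for an unknown $\bar W_i\in\mathcal W_i$, where $$\mathcal W_i:=\Big\{W\in\mathbb R^{n\times T_i}\ \Big|\ \begin{bmatrix} I \\ W^\top\end{bmatrix}^\top\Phi^i\begin{bmatrix} I \\ W^\top\end{bmatrix}\succcurlyeq 0\Big\},\qquad \Phi^i=\begin{bmatrix}\Phi^i_{1,1}&\Phi^i_{1,2} \\ {\Phi^i_{1,2}}^\top&\Phi^i_{2,2}\end{bmatrix}$$ with known symmetric $\Phi^i$ and $\Phi^i_{2,2}\prec0$ ($\Phi^i_{1,1}$ is $n\times n$, $\Phi^i_{2,2}$ is $T_i\times T_i$). The compatibility set is $\mathcal C_i:=\{(A_i,B_i)\in\mathbb R^{n\times n}\times\mathbb R^{n\times m}\mid \exists W\in\mathcal W_i:\ \dot X_i=A_iX_i+B_iU_i+W\}$. Equivalently, $(A_i,B_i)\in\mathcal C_i$ iff $\begin{bmatrix} I& A_i& B_i\end{bmatrix}H_i\begin{bmatrix} I& A_i& B_i\end{bmatrix}^\top\succcurlyeq0$, where $$H_i:=\begin{bmatrix} I&\dot X_i \\ 0&-X_i \\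 0&-U_i\end{bmatrix}\Phi^i\begin{bmatrix} I&\dot X_i \\ 0&-X_i \\ 0&-U_i\end{bmatrix}^\top .$$ $\succ,\succcurlyeq$ refer to symmetric matrices. $\mathcal M_+:=\{\Pi\in\mathbb R^{N\times N}\mid \pi_{i,j}>0\ \forall i\ne j,\ \sum_{i=1}^N\pi_{i,j}=0\ \forall j\}$. $\boldsymbol P_{-i}:=\mathrm{diag}((P_j)_{j\in\mathcal I\setminus\{i\}})$ and $\boldsymbol\pi_{-i}:=\mathrm{diag}((\pi_{j,i}I_n)_{j\in\mathcal I\setminus\{i\}})$ (block diagonal, same ordering). $\mathbf 1_{N-1}$ is the all-ones vector. The row blocks of $\Gamma_i$ have heights $n,(N-1)n,n,n,m$ and its column blocks have widths $n,T_i$. *)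

theory Defs
  imports Complex_Main "Jordan_Normal_Form.Gauss_Jordan_Elimination"
begin

text \<open>
  Matrices are those of \<open>Jordan_Normal_Form\<close>: the dimensions are natural numbers, so that the
  number of samples may depend on the mode \<open>i\<close>. Modes and matrix entries are indexed from 0,
  i.e. the index set \<open>{1,\<dots>,N}\<close> is rendered as \<open>{0..<N}\<close>.
\<close>

definition pd :: "real mat \<Rightarrow> bool" where
  "pd A \<longleftrightarrow> square_mat A \<and> A\<^sup>T = A \<and>
     (\<forall>v \<in> carrier_vec (dim_row A). v \<noteq> 0\<^sub>v (dim_row A) \<longrightarrow> v \<bullet> (A *\<^sub>v v) > 0)"

definition psd :: "real mat \<Rightarrow> bool" where
  "psd A \<longleftrightarrow> square_mat A \<and> A\<^sup>T = A \<and>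
     (\<forall>v \<in> carrier_vec (dim_row A). v \<bullet> (A *\<^sub>v v) \<ge> 0)"

definition nd :: "real mat \<Rightarrow> bool" where
  "nd A \<longleftrightarrow> pd (- A)"

definition nsd :: "real mat \<Rightarrow> bool" where
  "nsd A \<longleftrightarrow> psd (- A)"

text \<open>The inverse; meaningful only for invertible matrices.\<close>

definition minv :: "real mat \<Rightarrow> real mat" where
  "minv A = the (mat_inverse A)"

definition append_cols :: "'a :: zero mat \<Rightarrow> 'a mat \<Rightarrow> 'a mat" (infixr \<open>@\<^sub>c\<close> 65) where
  "A @\<^sub>c B = four_block_mat A B (0\<^sub>m 0 (dim_col A)) (0\<^sub>m 0 (dim_col B))"

fun hcat :: "'a :: zero mat list \<Rightarrow> 'a mat" where
  "hcat [] = 0\<^sub>m 0 0"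
| "hcat [A] = A"
| "hcat (A # As) = A @\<^sub>c hcat As"

fun vcat :: "'a :: zero mat list \<Rightarrow> 'a mat" where
  "vcat [] = 0\<^sub>m 0 0"
| "vcat [A] = A"
| "vcat (A # As) = A @\<^sub>r vcat As"

text \<open>A block matrix, given as the list of its block rows.\<close>

definition block_mat :: "'a :: zero mat list list \<Rightarrow> 'a mat" where
  "block_mat Rs = vcat (map hcat Rs)"

definition kronecker :: "'a :: times mat \<Rightarrow> 'a mat \<Rightarrow> 'a mat" (infixl \<open>\<otimes>\<^sub>m\<close> 70) where
  "A \<otimes>\<^sub>m B = mat (dim_row A * dim_row B) (dim_col A * dim_col B)
     (\<lambda>(i, j). A $$ (i div dim_row B, j div dim_col B) * B $$ (i mod dim_row B, j mod dim_col B))"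

definition ones_col :: "nat \<Rightarrow> real mat" where
  "ones_col k = mat k 1 (\<lambda>_. 1)"

definition mat_sum :: "nat \<Rightarrow> nat \<Rightarrow> ('i \<Rightarrow> real mat) \<Rightarrow> 'i set \<Rightarrow> real mat" where
  "mat_sum nr nc F J = mat nr nc (\<lambda>(k, l). \<Sum>j\<in>J. F j $$ (k, l))"

definition noise_set :: "nat \<Rightarrow> nat \<Rightarrow> real mat \<Rightarrow> real mat set" where
  "noise_set n T \<Phi> = {W \<in> carrier_mat n T.
     psd ((block_mat [[1\<^sub>m n], [W\<^sup>T]])\<^sup>T * \<Phi> * block_mat [[1\<^sub>m n], [W\<^sup>T]])}"

definition compat_set ::
  "nat \<Rightarrow> nat \<Rightarrow> nat \<Rightarrow> real mat \<Rightarrow> real mat \<Rightarrow> real mat \<Rightarrow> real mat \<Rightarrow> (real mat \<times> real mat) set" where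
  "compat_set n m T \<Phi> Xd X U = {(A, B). A \<in> carrier_mat n n \<and> B \<in> carrier_mat n m \<and>
     (\<exists>W \<in> noise_set n T \<Phi>. Xd = A * X + B * U + W)}"

definition H_mat ::
  "nat \<Rightarrow> nat \<Rightarrow> real mat \<Rightarrow> real mat \<Rightarrow> real mat \<Rightarrow> real mat \<Rightarrow> real mat" where
  "H_mat n m \<Phi> Xd X U =
     (let G = block_mat [[1\<^sub>m n, Xd],
                         [0\<^sub>m n n, - X],
                         [0\<^sub>m m n, - U]]
      in G * \<Phi> * G\<^sup>T)"

definition slater :: "nat \<Rightarrow> nat \<Rightarrow> real mat \<Rightarrow> bool" where
  "slater n m H \<longleftrightarrow> (\<exists>Z \<in> carrier_mat (n + m) n.
     pd (block_mat [[1\<^sub>m n, Z\<^sup>T]] * H * (block_mat [[1\<^sub>m n, Z\<^sup>T]])\<^sup>T))"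

definition M_plus :: "nat \<Rightarrow> real mat set" where
  "M_plus N = {\<pi> \<in> carrier_mat N N.
     (\<forall>i<N. \<forall>j<N. i \<noteq> j \<longrightarrow> \<pi> $$ (i, j) > 0) \<and> (\<forall>j<N. (\<Sum>i<N. \<pi> $$ (i, j)) = 0)}"

definition P_minus :: "nat \<Rightarrow> (nat \<Rightarrow> real mat) \<Rightarrow> nat \<Rightarrow> real mat" where
  "P_minus N P i = diag_block_mat (map P (filter (\<lambda>j. j \<noteq> i) [0..<N]))"

definition pi_minus :: "nat \<Rightarrow> nat \<Rightarrow> real mat \<Rightarrow> nat \<Rightarrow> real mat" where
  "pi_minus N n \<pi> i =
     diag_block_mat (map (\<lambda>j. \<pi> $$ (j, i) \<cdot>\<^sub>m 1\<^sub>m n) (filter (\<lambda>j. j \<noteq> i) [0..<N]))"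

definition Gamma_mat ::
  "nat \<Rightarrow> nat \<Rightarrow> nat \<Rightarrow> nat \<Rightarrow> real mat \<Rightarrow> real mat \<Rightarrow> real mat \<Rightarrow> real mat" where
  "Gamma_mat N n m T Xd X U = block_mat
     [[0\<^sub>m n n, 0\<^sub>m n T],
      [0\<^sub>m ((N - 1) * n) n, 0\<^sub>m ((N - 1) * n) T],
      [1\<^sub>m n, Xd],
      [0\<^sub>m n n, - X],
      [0\<^sub>m m n, - U]]"

definition lmi_mat ::
  "nat \<Rightarrow> nat \<Rightarrow> nat \<Rightarrow> real mat \<Rightarrow> (nat \<Rightarrow> real mat) \<Rightarrow> real mat \<Rightarrow> real mat \<Rightarrow> nat \<Rightarrow> real mat" where
  "lmi_mat N n m Q P \<pi> L i =
     (let k = (N - 1) * n; S = minv (P i); E = ones_col (N - 1) \<otimes>\<^sub>m 1\<^sub>m n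
      in block_mat
       [[minv Q,   0\<^sub>m n k,                                   S,                     0\<^sub>m n n, 0\<^sub>m n m],
        [0\<^sub>m k n, minv (pi_minus N n \<pi> i) * minv (P_minus N P i), E * S,                 0\<^sub>m k n, 0\<^sub>m k m],
        [S,        S * E\<^sup>T,                                  - (\<pi> $$ (i, i)) \<cdot>\<^sub>m S, - S,      - L\<^sup>T],
        [0\<^sub>m n n, 0\<^sub>m n k,                                  - S,                    0\<^sub>m n n, 0\<^sub>m n m],
        [0\<^sub>m m n, 0\<^sub>m m k,                                  - L,                    0\<^sub>m m n, 0\<^sub>m m m]])"

end

theory Submission
  imports Defs "Jordan_Normal_Form.Determinant"
begin

text \<open>
  Multiplying the Lyapunov inequality by \<open>S = P\<^sub>i\<^sup>-\<^sup>1\<close> on both sides turns it into nonnegativity of a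
  quadratic form \<open>f (u, w, z)\<close> on the graph \<open>w = A\<^sup>T u, z = B\<^sup>T u\<close>, while compatibility with the data
  is nonnegativity of the form \<open>g\<close> of \<open>H\<^sub>i\<close> on the same graph. The matrix S-lemma replaces the
  implication between the two by \<open>f \<ge> \<alpha> g\<close> everywhere, and completing two squares (a Schur complement)
  identifies the latter with the linear matrix inequality.

  The matrix S-lemma reduces to the one for vectors: a vector \<open>(u, y)\<close> with \<open>u \<noteq> 0\<close> and
  \<open>g (u, y) \<ge> 0\<close> lies on the graph of some \<open>Z\<close> that satisfies the matrix inequality, and \<open>Z\<close> can be
  taken as a rank-one correction of the Slater point. This uses that the lower right block of \<open>H\<^sub>i\<close>
  is negative semidefinite with kernel contained in that of \<open>H\<^sub>i\<close>, which follows from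
  \<open>\<Phi>\<^sub>2\<^sub>2 \<prec> 0\<close>; vectors with \<open>u = 0\<close> are harmless because \<open>f\<close> vanishes there.
\<close>

section \<open>Matrix-vector algebra\<close>

lemma mat_mult_vec_assoc:
  fixes A B :: "'a :: semiring_0 mat"
  assumes "dim_col A = dim_row B" "dim_col B = dim_vec v"
  shows "(A * B) *\<^sub>v v = A *\<^sub>v (B *\<^sub>v v)"
  by (rule assoc_mult_mat_vec[of _ "dim_row A" "dim_row B" _ "dim_col B"])
    (use assms in \<open>auto intro!: carrier_matI carrier_vecI\<close>)

lemma mat_mult_vec_add:
  fixes A :: "'a :: semiring_0 mat"
  assumes "dim_col A = dim_vec x" "dim_vec y = dim_vec x"
  shows "A *\<^sub>v (x + y) = A *\<^sub>v x + A *\<^sub>v y"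
  by (rule mult_add_distrib_mat_vec[of _ "dim_row A" "dim_col A"])
    (use assms in \<open>auto intro!: carrier_matI carrier_vecI\<close>)

lemma mat_mult_vec_smult:
  fixes A :: "'a :: comm_ring_1 mat"
  assumes "dim_col A = dim_vec x"
  shows "A *\<^sub>v (c \<cdot>\<^sub>v x) = c \<cdot>\<^sub>v (A *\<^sub>v x)"
  by (rule eq_vecI) (use assms in auto)

lemma add_mat_mult_vec:
  fixes A B :: "'a :: semiring_0 mat"
  assumes "dim_row B = dim_row A" "dim_col A = dim_vec v" "dim_col B = dim_vec v"
  shows "(A + B) *\<^sub>v v = A *\<^sub>v v + B *\<^sub>v v"
  by (rule add_mult_distrib_mat_vec[of _ "dim_row A" "dim_col A"])
    (use assms in \<open>auto intro!: carrier_matI carrier_vecI\<close>)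

lemma minus_mat_mult_vec:
  fixes A B :: "'a :: ring mat"
  assumes "dim_row B = dim_row A" "dim_col A = dim_vec v" "dim_col B = dim_vec v"
  shows "(A - B) *\<^sub>v v = A *\<^sub>v v - B *\<^sub>v v"
  by (rule minus_mult_distrib_mat_vec[of _ "dim_row A" "dim_col A"])
    (use assms in \<open>auto intro!: carrier_matI carrier_vecI\<close>)

lemma smult_mat_mult_vec:
  fixes A :: "'a :: comm_ring_1 mat"
  assumes "dim_col A = dim_vec v"
  shows "(c \<cdot>\<^sub>m A) *\<^sub>v v = c \<cdot>\<^sub>v (A *\<^sub>v v)"
  by (rule eq_vecI) (use assms in auto)

lemma one_mat_mult_vec:
  fixes v :: "'a :: semiring_1 vec"
  assumes "dim_vec v = k"
  shows "1\<^sub>m k *\<^sub>v v = v"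
  using assms by (intro one_mult_mat_vec carrier_vecI)

lemma zero_mat_mult_vec:
  fixes v :: "'a :: semiring_0 vec"
  assumes "dim_vec v = k"
  shows "0\<^sub>m r k *\<^sub>v v = 0\<^sub>v r"
  using assms by (intro eq_vecI) auto

lemma mat_mult_vec_zero:
  fixes A :: "'a :: semiring_0 mat"
  assumes "dim_col A = k"
  shows "A *\<^sub>v 0\<^sub>v k = 0\<^sub>v (dim_row A)"
  using assms by (intro eq_vecI) auto

lemma scalar_prod_add_left:
  fixes x y z :: "'a :: semiring_0 vec"
  assumes "dim_vec x = dim_vec z" "dim_vec y = dim_vec z"
  shows "(x + y) \<bullet> z = x \<bullet> z + y \<bullet> z"
  by (rule add_scalar_prod_distrib[of _ "dim_vec z"]) (use assms in \<open>auto intro!: carrier_vecI\<close>)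

lemma scalar_prod_add_right:
  fixes x y z :: "'a :: semiring_0 vec"
  assumes "dim_vec x = dim_vec z" "dim_vec y = dim_vec z"
  shows "z \<bullet> (x + y) = z \<bullet> x + z \<bullet> y"
  by (rule scalar_prod_add_distrib[of _ "dim_vec z"]) (use assms in \<open>auto intro!: carrier_vecI\<close>)

lemma scalar_prod_minus_right:
  fixes x y z :: "'a :: ring vec"
  assumes "dim_vec x = dim_vec z" "dim_vec y = dim_vec z"
  shows "z \<bullet> (x - y) = z \<bullet> x - z \<bullet> y"
  by (rule scalar_prod_minus_distrib[of _ "dim_vec z"]) (use assms in \<open>auto intro!: carrier_vecI\<close>)

lemma scalar_prod_commute:
  fixes x y :: "'a :: comm_semiring_0 vec"
  assumes "dim_vec x = dim_vec y"
  shows "x \<bullet> y = y \<bullet> x"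
  by (rule comm_scalar_prod[of _ "dim_vec y"]) (use assms in \<open>auto intro!: carrier_vecI\<close>)

lemma scalar_prod_zero_left: "dim_vec y = k \<Longrightarrow> 0\<^sub>v k \<bullet> y = (0 :: 'a :: semiring_0)"
  by (auto simp: scalar_prod_def)

lemma scalar_prod_zero_right: "dim_vec y = k \<Longrightarrow> y \<bullet> 0\<^sub>v k = (0 :: 'a :: semiring_0)"
  by (auto simp: scalar_prod_def)

lemma scalar_prod_transpose_mult:
  fixes A :: "'a :: comm_semiring_0 mat"
  assumes "dim_row A = dim_vec y" "dim_col A = dim_vec x"
  shows "(A\<^sup>T *\<^sub>v y) \<bullet> x = y \<bullet> (A *\<^sub>v x)"
  by (rule transpose_vec_mult_scalar[of _ "dim_row A" "dim_col A"])
    (use assms in \<open>auto intro!: carrier_matI carrier_vecI\<close>)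

lemma scalar_prod_mult_transpose:
  fixes A :: "'a :: comm_semiring_0 mat"
  assumes "dim_row A = dim_vec y" "dim_col A = dim_vec x"
  shows "x \<bullet> (A\<^sup>T *\<^sub>v y) = (A *\<^sub>v x) \<bullet> y"
  using scalar_prod_transpose_mult[OF assms] scalar_prod_commute[of x "A\<^sup>T *\<^sub>v y"]
    scalar_prod_commute[of y "A *\<^sub>v x"] assms by simp

lemma scalar_prod_append_vec:
  fixes a b c d :: "'a :: semiring_0 vec"
  assumes "dim_vec a = dim_vec c" "dim_vec b = dim_vec d"
  shows "(a @\<^sub>v b) \<bullet> (c @\<^sub>v d) = a \<bullet> c + b \<bullet> d"
  by (rule scalar_prod_append[of _ "dim_vec c" _ "dim_vec d"])
    (use assms in \<open>auto intro!: carrier_vecI\<close>)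

lemma add_append_vec:
  fixes a b c d :: "'a :: monoid_add vec"
  assumes "dim_vec a = dim_vec c" "dim_vec b = dim_vec d"
  shows "(a @\<^sub>v b) + (c @\<^sub>v d) = (a + c) @\<^sub>v (b + d)"
  by (rule eq_vecI) (use assms in auto)

lemma dim_append_cols [simp]:
  "dim_row (A @\<^sub>c B) = dim_row A"
  "dim_col (A @\<^sub>c B) = dim_col A + dim_col B"
  by (auto simp: append_cols_def)

lemma dim_append_rows [simp]:
  "dim_row (A @\<^sub>r B) = dim_row A + dim_row B"
  "dim_col (A @\<^sub>r B) = dim_col A"
  by (auto simp: append_rows_def)

lemma append_rows_mult_vec:
  fixes A B :: "'a :: comm_semiring_1 mat"
  assumes "dim_col A = dim_vec v" "dim_col B = dim_vec v"
  shows "(A @\<^sub>r B) *\<^sub>v v = (A *\<^sub>v v) @\<^sub>v (B *\<^sub>v v)"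
  by (rule mat_mult_append[of _ "dim_row A" "dim_vec v" _ "dim_row B"])
    (use assms in \<open>auto intro!: carrier_matI carrier_vecI\<close>)

lemma append_cols_mult_vec:
  fixes A B :: "'a :: comm_ring_1 mat"
  assumes "dim_row B = dim_row A" "dim_col A = dim_vec a" "dim_col B = dim_vec b"
  shows "(A @\<^sub>c B) *\<^sub>v (a @\<^sub>v b) = A *\<^sub>v a + B *\<^sub>v b"
proof -
  have "(A @\<^sub>c B) *\<^sub>v (a @\<^sub>v b) =
      (A *\<^sub>v a + B *\<^sub>v b) @\<^sub>v (0\<^sub>m 0 (dim_col A) *\<^sub>v a + 0\<^sub>m 0 (dim_col B) *\<^sub>v b)"
    unfolding append_cols_def
    by (rule four_block_mat_mult_vec[of _ "dim_row A" "dim_col A" _ "dim_col B" _ 0])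
      (use assms in \<open>auto intro!: carrier_matI carrier_vecI\<close>)
  also have "\<dots> = A *\<^sub>v a + B *\<^sub>v b"
    by (rule eq_vecI) (use assms in auto)
  finally show ?thesis .
qed

lemma transpose_append_rows:
  assumes "dim_col B = dim_col A"
  shows "(A @\<^sub>r B)\<^sup>T = A\<^sup>T @\<^sub>c B\<^sup>T"
  by (rule eq_matI) (use assms in \<open>auto simp: append_rows_def append_cols_def\<close>)

lemma transpose_append_cols:
  assumes "dim_row B = dim_row A"
  shows "(A @\<^sub>c B)\<^sup>T = A\<^sup>T @\<^sub>r B\<^sup>T"
  by (rule eq_matI) (use assms in \<open>auto simp: append_rows_def append_cols_def\<close>)

text \<open>These rules have equations between dimensions as side conditions instead of carrier
  memberships, so the simplifier can discharge them. Together they expand the form of a block matrix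
  at block vectors into inner products of the blocks.\<close>

lemmas mat_vec_simps =
  mat_mult_vec_assoc mat_mult_vec_add mat_mult_vec_smult mat_mult_vec_zero
  add_mat_mult_vec minus_mat_mult_vec smult_mat_mult_vec one_mat_mult_vec zero_mat_mult_vec
  scalar_prod_add_left scalar_prod_add_right scalar_prod_minus_right
  scalar_prod_zero_left scalar_prod_zero_right
  scalar_prod_transpose_mult scalar_prod_mult_transpose scalar_prod_append_vec
  append_rows_mult_vec append_cols_mult_vec add_append_vec

section \<open>Symmetric matrices and their quadratic forms\<close>

lemma symmetric_matI:
  fixes A :: "'a :: semiring_1 mat"
  assumes A: "A \<in> carrier_mat k k"
    and sym: "\<And>x y. x \<in> carrier_vec k \<Longrightarrow> y \<in> carrier_vec k \<Longrightarrow> x \<bullet> (A *\<^sub>v y) = y \<bullet> (A *\<^sub>v x)"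
  shows "A\<^sup>T = A"
proof (rule eq_matI)
  fix i j assume "i < dim_row A" "j < dim_col A"
  then have ij: "i < k" "j < k" using A by auto
  \<comment> \<open>Unit vectors pick out single entries. Symmetry of a large block matrix can thus
    be read off its bilinear form, without transposing blocks.\<close>
  have entry: "unit_vec k a \<bullet> (A *\<^sub>v unit_vec k b) = A $$ (a, b)" if "a < k" "b < k" for a b
    using that A by (subst scalar_prod_left_unit) auto
  show "A\<^sup>T $$ (i, j) = A $$ (i, j)"
    using sym[of "unit_vec k i" "unit_vec k j"] entry[OF ij] entry[OF ij(2) ij(1)] ij A by simp
qed (use A in auto)

lemma scalar_prod_symmetric_mat:
  fixes A :: "'a :: comm_semiring_0 mat"
  assumes "A\<^sup>T = A" "A \<in> carrier_mat k k" "x \<in> carrier_vec k" "y \<in> carrier_vec k"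
  shows "x \<bullet> (A *\<^sub>v y) = y \<bullet> (A *\<^sub>v x)"
proof -
  have "x \<bullet> (A *\<^sub>v y) = (A\<^sup>T *\<^sub>v x) \<bullet> y"
    by (rule scalar_prod_transpose_mult[symmetric]) (use assms in auto)
  also have "\<dots> = y \<bullet> (A *\<^sub>v x)"
    unfolding assms(1) by (rule scalar_prod_commute) (use assms in auto)
  finally show ?thesis .
qed

lemma quadratic_form_add_smult:
  fixes A :: "real mat"
  assumes sym: "A\<^sup>T = A" and A: "A \<in> carrier_mat k k"
    and x: "x \<in> carrier_vec k" and y: "y \<in> carrier_vec k"
  shows "(x + t \<cdot>\<^sub>v y) \<bullet> (A *\<^sub>v (x + t \<cdot>\<^sub>v y)) =
    x \<bullet> (A *\<^sub>v x) + 2 * (x \<bullet> (A *\<^sub>v y)) * t + (y \<bullet> (A *\<^sub>v y)) * t\<^sup>2"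
proof -
  note [simp] = carrier_vecD[OF x] carrier_vecD[OF y] carrier_matD[OF A]
  show ?thesis
    by (simp add: mat_vec_simps scalar_prod_symmetric_mat[OF sym A y x] algebra_simps power2_eq_square)
qed

section \<open>The S-lemma for vectors and for matrices\<close>

text \<open>The first polynomial has real roots \<open>s < 0 < t\<close> with product
  \<open>a / c\<close>, and a positive combination of the values of the second at these roots gives
  \<open>p \<ge> s * t * r\<close>. In the S-lemma the polynomials are the restrictions of
  \<open>g\<close> and \<open>f\<close> to a line.\<close>

lemma quadratic_pair_roots:
  fixes a b c p q r :: real
  assumes "a > 0" "c < 0"
    and roots: "\<And>t. a + 2 * b * t + c * t\<^sup>2 = 0 \<Longrightarrow> p + 2 * q * t + r * t\<^sup>2 \<ge> 0"
  shows "p * c \<le> r * a"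
proof -
  define d where "d = sqrt (b\<^sup>2 - a * c)"
  have ac: "a * c < 0" using assms by (simp add: mult_pos_neg)
  then have "b\<^sup>2 - a * c \<ge> 0" using zero_le_power2[of b] by linarith
  then have d2: "d\<^sup>2 = b\<^sup>2 - a * c" unfolding d_def by simp
  have d: "d > 0" unfolding d_def using ac by (smt (verit) real_sqrt_gt_zero zero_le_power2)
  \<comment> \<open>Since \<open>c < 0\<close>, the plus sign gives the smaller root.\<close>
  define s where "s = (- b + d) / c"
  define t where "t = (- b - d) / c"
  have st: "s + t = - 2 * b / c" "s * t = a / c"
  proof -
    show "s + t = - 2 * b / c" by (simp add: s_def t_def flip: add_divide_distrib)
    have "s * t = (b\<^sup>2 - d\<^sup>2) / c\<^sup>2" by (simp add: s_def t_def field_simps power2_eq_square)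
    also have "\<dots> = a / c" using assms by (simp add: d2 power2_eq_square[of c])
    finally show "s * t = a / c" .
  qed
  have root: "a + 2 * b * x + c * x\<^sup>2 = 0" if "x = s \<or> x = t" for x
  proof -
    have "a + 2 * b * x + c * x\<^sup>2 = c * (s * t - (s + t) * x + x\<^sup>2)"
      unfolding st using assms by (simp add: field_simps)
    also have "s * t - (s + t) * x + x\<^sup>2 = 0"
      using that by (auto simp: power2_eq_square algebra_simps)
    finally show ?thesis by simp
  qed
  have "t - s > 0" using d assms by (simp add: s_def t_def field_simps)
  moreover have "s * t < 0" using st assms by (simp add: divide_pos_neg)
  ultimately have "s < 0" "t > 0" by (auto simp: mult_less_0_iff)
  \<comment> \<open>This combination of the two inequalities cancels the unknown coefficient \<open>q\<close>.\<close>
  have "0 \<le> t * (p + 2 * q * s + r * s\<^sup>2) + (- s) * (p + 2 * q * t + r * t\<^sup>2)"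
    using roots[OF root, of s] roots[OF root, of t] \<open>s < 0\<close> \<open>t > 0\<close>
    by (intro add_nonneg_nonneg[of "t * _"] mult_nonneg_nonneg) (simp_all only: simp_thms neg_0_le_iff_le less_imp_le)
  also have "\<dots> = (t - s) * (p - (s * t) * r)"
    by (simp add: algebra_simps power2_eq_square)
  finally have "p \<ge> (s * t) * r" using \<open>t - s > 0\<close> by (simp add: zero_le_mult_iff)
  then show ?thesis unfolding st using assms by (simp add: field_simps)
qed

text \<open>A multiplier has to lie above the ratios \<open>f y / g y\<close> where
  \<open>g y < 0\<close> and below the ratios \<open>f x / g x\<close> where \<open>g x > 0\<close>.
  Restricting both forms to the line through \<open>x\<close> in direction \<open>y\<close> shows
  that no lower bound exceeds an upper one, so the supremum of the lower bounds works.\<close>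

lemma S_lemma:
  fixes M G :: "real mat"
  assumes M: "M \<in> carrier_mat k k" "M\<^sup>T = M" and G: "G \<in> carrier_mat k k" "G\<^sup>T = G"
    and x0: "x\<^sub>0 \<in> carrier_vec k" "x\<^sub>0 \<bullet> (G *\<^sub>v x\<^sub>0) > 0"
    and imp: "\<And>x. x \<in> carrier_vec k \<Longrightarrow> x \<bullet> (G *\<^sub>v x) \<ge> 0 \<Longrightarrow> x \<bullet> (M *\<^sub>v x) \<ge> 0"
  shows "\<exists>\<alpha>\<ge>0. \<forall>x\<in>carrier_vec k. x \<bullet> (M *\<^sub>v x) \<ge> \<alpha> * (x \<bullet> (G *\<^sub>v x))"
proof -
  define f where "f x = x \<bullet> (M *\<^sub>v x)" for x
  define g where "g x = x \<bullet> (G *\<^sub>v x)" for x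
  have separated: "f y / g y \<le> f x / g x"
    if "x \<in> carrier_vec k" "y \<in> carrier_vec k" "g x > 0" "g y < 0" for x y
  proof -
    have "f x * g y \<le> f y * g x"
    proof (rule quadratic_pair_roots[OF that(3,4)])
      fix t
      assume "g x + 2 * (x \<bullet> (G *\<^sub>v y)) * t + g y * t\<^sup>2 = 0"
      then have "g (x + t \<cdot>\<^sub>v y) = 0"
        using quadratic_form_add_smult[OF G(2,1) that(1,2), of t] by (simp add: g_def)
      then have "f (x + t \<cdot>\<^sub>v y) \<ge> 0"
        using imp[of "x + t \<cdot>\<^sub>v y"] that by (simp add: f_def g_def)
      then show "0 \<le> f x + 2 * (x \<bullet> (M *\<^sub>v y)) * t + f y * t\<^sup>2"
        using quadratic_form_add_smult[OF M(2,1) that(1,2), of t] by (simp add: f_def)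
    qed
    then show ?thesis using that by (simp add: field_simps)
  qed
  \<comment> \<open>The extra element 0 makes the supremum nonnegative and the set nonempty. It
    respects the upper bounds because \<open>f x \<ge> 0\<close> wherever \<open>g x > 0\<close>;
    the Slater vector provides one such bound.\<close>
  define S where "S = insert 0 ((\<lambda>y. f y / g y) ` {y \<in> carrier_vec k. g y < 0})"
  have upper: "s \<le> f x / g x" if "s \<in> S" "x \<in> carrier_vec k" "g x > 0" for s x
    using that separated imp[of x] by (auto simp: S_def f_def g_def)
  have bdd: "bdd_above S" using upper[OF _ x0(1)] x0(2) by (auto simp: g_def intro!: bdd_aboveI)
  have "0 \<le> Sup S" using bdd by (intro cSup_upper) (auto simp: S_def)
  moreover have "f x \<ge> Sup S * g x" if x: "x \<in> carrier_vec k" for x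
  proof (cases "g x" "0 :: real" rule: linorder_cases)
    case less
    then have "f x / g x \<le> Sup S" using bdd x by (intro cSup_upper) (auto simp: S_def)
    then show ?thesis using less by (simp add: field_simps)
  next
    case equal
    then show ?thesis using imp[OF x] by (simp add: f_def g_def)
  next
    case greater
    then have "Sup S \<le> f x / g x" using upper x by (intro cSup_least) (auto simp: S_def)
    then show ?thesis using greater by (simp add: field_simps)
  qed
  ultimately show ?thesis by (auto simp: f_def g_def)
qed

text \<open>The quadratic is evaluated at its minimiser \<open>- b / c\<close>. Applied along a line
  \<open>v + t u\<close>, this is the Cauchy-Schwarz inequality for a semidefinite form.\<close>

lemma real_form_Cauchy_Schwarz:
  fixes a b c :: real
  assumes "c > 0" and nonneg: "\<And>t. a + 2 * b * t + c * t\<^sup>2 \<ge> 0"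
  shows "b\<^sup>2 \<le> c * a"
proof -
  have "a + 2 * b * (- b / c) + c * (- b / c)\<^sup>2 = a - b\<^sup>2 / c"
    using assms(1) by (simp add: power2_eq_square field_simps)
  then have "b\<^sup>2 / c \<le> a" using nonneg[of "- b / c"] by linarith
  then show ?thesis using assms(1) by (simp add: pos_divide_le_eq mult.commute)
qed

text \<open>In \<open>matrix_S_lemma\<close> the expression in \<open>v\<close> is the form of
  \<open>G\<close> at \<open>E v + (p \<bullet> v) d\<close>, a point of the graph corrected by a
  rank-one term. For \<open>v = u\<close> it reduces to \<open>at_u\<close>, so this necessary
  condition turns out to be sufficient for a suitable \<open>p\<close>.\<close>

lemma rank_one_perturbation_psd:
  fixes R :: "real mat"
  assumes R: "R \<in> carrier_mat n n" "pd R"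
    and s: "s \<in> carrier_vec n" and u: "u \<in> carrier_vec n" "u \<noteq> 0\<^sub>v n"
    and \<nu>: "\<nu> \<le> 0" "\<nu> = 0 \<Longrightarrow> s = 0\<^sub>v n"
    and at_u: "u \<bullet> (R *\<^sub>v u) + 2 * (s \<bullet> u) + \<nu> \<ge> 0"
  shows "\<exists>p\<in>carrier_vec n. p \<bullet> u = 1 \<and>
    (\<forall>v\<in>carrier_vec n. v \<bullet> (R *\<^sub>v v) + 2 * (s \<bullet> v) * (p \<bullet> v) + \<nu> * (p \<bullet> v)\<^sup>2 \<ge> 0)"
proof -
  note [simp] = carrier_vecD[OF s] carrier_vecD[OF u(1)] carrier_matD[OF R(1)]
  have symR: "R\<^sup>T = R" using R by (simp add: pd_def)
  have pos: "v \<bullet> (R *\<^sub>v v) \<ge> 0" if "v \<in> carrier_vec n" for v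
    using R that by (cases "v = 0\<^sub>v n") (auto simp: pd_def less_imp_le mat_vec_simps)
  have posu: "u \<bullet> (R *\<^sub>v u) > 0" using R u by (auto simp: pd_def)
  have comm: "(R *\<^sub>v u) \<bullet> v = u \<bullet> (R *\<^sub>v v)" if "v \<in> carrier_vec n" for v
    using scalar_prod_transpose_mult[of R u v] that symR by simp
  show ?thesis
  proof (cases "\<nu> = 0")
    case True
    \<comment> \<open>Here \<open>s = 0\<close>, so only the form of \<open>R\<close> remains and
      any \<open>p\<close> with \<open>p \<bullet> u = 1\<close> would do.\<close>
    define p where "p = (1 / (u \<bullet> (R *\<^sub>v u))) \<cdot>\<^sub>v (R *\<^sub>v u)"
    have "p \<in> carrier_vec n" by (auto simp: p_def intro!: carrier_vecI)
    moreover have "p \<bullet> u = 1" using posu comm[OF u(1)] by (simp add: p_def)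
    ultimately show ?thesis using True \<nu>(2) pos by (auto simp: mat_vec_simps)
  next
    case False
    \<comment> \<open>With \<open>r = R + s s\<^sup>T / \<mu>\<close> and \<open>p = q + s / \<mu>\<close>, the form in question is \<open>r (v, v) - \<mu> (q \<bullet> v)\<^sup>2\<close>.
      Among all \<open>q\<close> with prescribed \<open>q \<bullet> u\<close>, the choice \<open>q = l r u\<close> makes \<open>q q\<^sup>T\<close> smallest
      relative to \<open>r\<close>, and the bound it needs is exactly the hypothesis at \<open>u\<close>.\<close>
    define \<mu> where "\<mu> = - \<nu>"
    have \<mu>: "\<mu> > 0" "\<nu> = - \<mu>" using False \<nu>(1) by (auto simp: \<mu>_def)
    define r where "r v w = v \<bullet> (R *\<^sub>v w) + (s \<bullet> v) * (s \<bullet> w) / \<mu>" for v w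
    have ruu: "r u u > 0" using posu \<mu> by (simp add: r_def add_pos_nonneg)
    \<comment> \<open>The solution of \<open>p \<bullet> u = 1\<close>, given that
      \<open>p \<bullet> u = l * r u u + (s \<bullet> u) / \<mu>\<close>.\<close>
    define l where "l = (1 - (s \<bullet> u) / \<mu>) / r u u"
    define p where "p = l \<cdot>\<^sub>v (R *\<^sub>v u) + ((l * (s \<bullet> u) + 1) / \<mu>) \<cdot>\<^sub>v s"
    have p: "p \<in> carrier_vec n" by (auto simp: p_def intro!: carrier_vecI)
    have pv: "p \<bullet> v = l * r u v + (s \<bullet> v) / \<mu>" if v: "v \<in> carrier_vec n" for v
      using carrier_vecD[OF v] \<mu>(1)
      by (simp add: p_def r_def mat_vec_simps comm[OF v] field_simps)
    have pu: "p \<bullet> u = 1" using ruu by (simp add: pv[OF u(1)] l_def)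
    have "\<mu> * (1 - (s \<bullet> u) / \<mu>)\<^sup>2 = \<mu> - 2 * (s \<bullet> u) + (s \<bullet> u)\<^sup>2 / \<mu>"
      using \<mu>(1) by (simp add: power2_eq_square field_simps)
    also have "\<dots> \<le> r u u" using at_u \<mu>(2) by (simp add: r_def power2_eq_square)
    finally have "\<mu> * (1 - (s \<bullet> u) / \<mu>)\<^sup>2 / r u u \<le> 1" using ruu by (simp add: divide_le_eq)
    \<comment> \<open>With Cauchy-Schwarz for \<open>r\<close> this bounds \<open>\<mu> (q \<bullet>
      v)\<^sup>2 = \<mu> l\<^sup>2 (r u v)\<^sup>2\<close> by \<open>r v v\<close>.\<close>
    then have lr: "\<mu> * l\<^sup>2 * r u u \<le> 1"
      using ruu by (simp add: l_def power2_eq_square)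
    have "v \<bullet> (R *\<^sub>v v) + 2 * (s \<bullet> v) * (p \<bullet> v) + \<nu> * (p \<bullet> v)\<^sup>2 \<ge> 0"
      if v: "v \<in> carrier_vec n" for v
    proof -
      note [simp] = carrier_vecD[OF v]
      have rvv: "r v v \<ge> 0" using pos[OF v] \<mu> by (simp add: r_def)
      have "(r u v)\<^sup>2 \<le> r u u * r v v"
      proof (rule real_form_Cauchy_Schwarz[OF ruu])
        fix t
        have "0 \<le> r (v + t \<cdot>\<^sub>v u) (v + t \<cdot>\<^sub>v u)"
          using pos[of "v + t \<cdot>\<^sub>v u"] u v \<mu> by (simp add: r_def)
        also have "\<dots> = r v v + 2 * r u v * t + r u u * t\<^sup>2"
          using \<mu>(1) unfolding r_def quadratic_form_add_smult[OF symR R(1) v u(1)]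
          by (simp add: mat_vec_simps scalar_prod_symmetric_mat[OF symR R(1) v u(1)]
              power2_eq_square field_simps)
        finally show "0 \<le> r v v + 2 * r u v * t + r u u * t\<^sup>2" .
      qed
      then have "\<mu> * l\<^sup>2 * (r u v)\<^sup>2 \<le> \<mu> * l\<^sup>2 * (r u u * r v v)"
        using \<mu> by (intro mult_left_mono) auto
      also have "\<dots> \<le> r v v"
        using mult_right_mono[OF lr rvv] by (simp add: mult.assoc)
      finally have "0 \<le> r v v - \<mu> * (l * r u v)\<^sup>2" by (simp add: power_mult_distrib mult.assoc)
      also have "\<dots> = v \<bullet> (R *\<^sub>v v) + 2 * (s \<bullet> v) * (p \<bullet> v) + \<nu> * (p \<bullet> v)\<^sup>2"
        using \<mu>(1) unfolding pv[OF v] \<mu>(2)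
        by (simp add: r_def[of v v] power2_eq_square field_simps)
      finally show ?thesis .
    qed
    with p pu show ?thesis by auto
  qed
qed

text \<open>The hypothesis \<open>imp\<close> concerns whole graphs, while \<open>S_lemma\<close>
  asks for an implication between values at single vectors; \<open>lift\<close> bridges the gap.
  Vectors with \<open>u = 0\<close> are covered by \<open>M22\<close>. For the others,
  \<open>G22\<close> and \<open>ker\<close> give the sign conditions of
  \<open>rank_one_perturbation_psd\<close>, and the Slater point gives the positive definite
  \<open>R\<close>.\<close>

lemma matrix_S_lemma:
  fixes M G Z\<^sub>0 :: "real mat"
  assumes M: "M \<in> carrier_mat (n + l) (n + l)" "M\<^sup>T = M"
    and G: "G \<in> carrier_mat (n + l) (n + l)" "G\<^sup>T = G"
    and M22: "\<And>w. w \<in> carrier_vec l \<Longrightarrow> (0\<^sub>v n @\<^sub>v w) \<bullet> (M *\<^sub>v (0\<^sub>v n @\<^sub>v w)) \<ge> 0"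
    and G22: "\<And>w. w \<in> carrier_vec l \<Longrightarrow> (0\<^sub>v n @\<^sub>v w) \<bullet> (G *\<^sub>v (0\<^sub>v n @\<^sub>v w)) \<le> 0"
    and ker: "\<And>w. w \<in> carrier_vec l \<Longrightarrow> (0\<^sub>v n @\<^sub>v w) \<bullet> (G *\<^sub>v (0\<^sub>v n @\<^sub>v w)) = 0 \<Longrightarrow>
        G *\<^sub>v (0\<^sub>v n @\<^sub>v w) = 0\<^sub>v (n + l)"
    and Z0: "Z\<^sub>0 \<in> carrier_mat l n" "pd ((1\<^sub>m n @\<^sub>r Z\<^sub>0)\<^sup>T * G * (1\<^sub>m n @\<^sub>r Z\<^sub>0))"
    and imp: "\<And>Z. Z \<in> carrier_mat l n \<Longrightarrow>
        \<forall>u\<in>carrier_vec n. (u @\<^sub>v Z *\<^sub>v u) \<bullet> (G *\<^sub>v (u @\<^sub>v Z *\<^sub>v u)) \<ge> 0 \<Longrightarrow>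
        \<forall>u\<in>carrier_vec n. (u @\<^sub>v Z *\<^sub>v u) \<bullet> (M *\<^sub>v (u @\<^sub>v Z *\<^sub>v u)) \<ge> 0"
  shows "\<exists>\<alpha>\<ge>0. \<forall>x\<in>carrier_vec (n + l). x \<bullet> (M *\<^sub>v x) \<ge> \<alpha> * (x \<bullet> (G *\<^sub>v x))"
proof (cases "n = 0")
  case True
  \<comment> \<open>For \<open>n = 0\<close> the Slater point yields no nonzero vector, but
    \<open>M22\<close> already covers every \<open>x\<close>, so the multiplier 0 works.\<close>
  have "x \<bullet> (M *\<^sub>v x) \<ge> 0" if "x \<in> carrier_vec (n + l)" for x
  proof -
    have "0\<^sub>v n @\<^sub>v x = x" using that True by (intro eq_vecI) auto
    then show ?thesis using M22[of x] that True by simp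
  qed
  then show ?thesis by (intro exI[of _ 0]) auto
next
  case False
  note [simp] = carrier_matD[OF Z0(1)] carrier_matD[OF G(1)]
  define E where "E = 1\<^sub>m n @\<^sub>r Z\<^sub>0"
  have E: "E \<in> carrier_mat (n + l) n" using Z0 by (auto simp: E_def)
  note [simp] = carrier_matD[OF E]
  define R where "R = E\<^sup>T * G * E"
  have R: "R \<in> carrier_mat n n" "pd R"
    using Z0(2) by (auto simp: R_def intro!: carrier_matI simp flip: E_def)
  have Ev: "E *\<^sub>v v = v @\<^sub>v Z\<^sub>0 *\<^sub>v v" if "v \<in> carrier_vec n" for v
    using carrier_vecD[OF that] by (simp add: E_def mat_vec_simps)
  have Rv: "v \<bullet> (R *\<^sub>v v) = (E *\<^sub>v v) \<bullet> (G *\<^sub>v (E *\<^sub>v v))" if "v \<in> carrier_vec n" for v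
    using carrier_vecD[OF that] scalar_prod_transpose_mult[of "E\<^sup>T" v "G *\<^sub>v (E *\<^sub>v v)"]
    by (simp add: R_def mat_vec_simps)
  have lift: "x \<bullet> (M *\<^sub>v x) \<ge> 0"
    if x: "x \<in> carrier_vec (n + l)" and gx: "x \<bullet> (G *\<^sub>v x) \<ge> 0" for x
  proof -
    define u where "u = vec_first x n"
    define w where "w = vec_last x l"
    have uw: "u \<in> carrier_vec n" "w \<in> carrier_vec l" "x = u @\<^sub>v w"
      using x by (auto simp: u_def w_def)
    note [simp] = carrier_vecD[OF uw(1)] carrier_vecD[OF uw(2)]
    show ?thesis
    proof (cases "u = 0\<^sub>v n")
      case True
      then show ?thesis using M22 uw by simp
    next
      case False
      \<comment> \<open>The deviation of \<open>x\<close> from the graph of the Slater point: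
        \<open>x = E u + d\<close> with \<open>d\<close> having upper part 0 and lower part
        \<open>w'\<close>.\<close>
      define w' where "w' = w - Z\<^sub>0 *\<^sub>v u"
      have w': "w' \<in> carrier_vec l" by (auto simp: w'_def intro!: carrier_vecI)
      define d where "d = 0\<^sub>v n @\<^sub>v w'"
      have d: "d \<in> carrier_vec (n + l)" using w' by (auto simp: d_def)
      note [simp] = carrier_vecD[OF w'] carrier_vecD[OF d]
      \<comment> \<open>The cross term of the form of \<open>G\<close> between the Slater graph and
        \<open>d\<close>.\<close>
      define s where "s = E\<^sup>T *\<^sub>v (G *\<^sub>v d)"
      have s: "s \<in> carrier_vec n" by (auto simp: s_def intro!: carrier_vecI)
      have sv: "s \<bullet> v = (E *\<^sub>v v) \<bullet> (G *\<^sub>v d)" if "v \<in> carrier_vec n" for v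
        using carrier_vecD[OF that] scalar_prod_commute[of "G *\<^sub>v d" "E *\<^sub>v v"]
        by (simp add: s_def mat_vec_simps)
      define \<nu> where "\<nu> = d \<bullet> (G *\<^sub>v d)"
      have expand: "(E *\<^sub>v v + t \<cdot>\<^sub>v d) \<bullet> (G *\<^sub>v (E *\<^sub>v v + t \<cdot>\<^sub>v d)) =
          v \<bullet> (R *\<^sub>v v) + 2 * (s \<bullet> v) * t + \<nu> * t\<^sup>2" if "v \<in> carrier_vec n" for v t
        using quadratic_form_add_smult[OF G(2,1) mult_mat_vec_carrier[OF E that] d, of t]
        by (simp only: Rv[OF that] sv[OF that] \<nu>_def)
      have xd: "x = E *\<^sub>v u + 1 \<cdot>\<^sub>v d"
        unfolding Ev[OF uw(1)] d_def uw(3) by (rule eq_vecI) (auto simp: w'_def)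
      have "\<exists>p\<in>carrier_vec n. p \<bullet> u = 1 \<and>
          (\<forall>v\<in>carrier_vec n. v \<bullet> (R *\<^sub>v v) + 2 * (s \<bullet> v) * (p \<bullet> v) + \<nu> * (p \<bullet> v)\<^sup>2 \<ge> 0)"
      proof (rule rank_one_perturbation_psd[OF R s uw(1) False])
        show "\<nu> \<le> 0" using G22[OF w'] by (simp add: \<nu>_def d_def)
        show "s = 0\<^sub>v n" if "\<nu> = 0"
        proof -
          have "G *\<^sub>v d = 0\<^sub>v (n + l)" using ker[OF w'] that by (simp add: \<nu>_def d_def)
          then show ?thesis by (simp add: s_def mat_vec_simps)
        qed
        show "u \<bullet> (R *\<^sub>v u) + 2 * (s \<bullet> u) + \<nu> \<ge> 0"
          using gx expand[OF uw(1), of 1] unfolding xd by simp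
      qed
      then obtain p where p: "p \<in> carrier_vec n" "p \<bullet> u = 1"
        and psd_p: "\<And>v. v \<in> carrier_vec n \<Longrightarrow>
          v \<bullet> (R *\<^sub>v v) + 2 * (s \<bullet> v) * (p \<bullet> v) + \<nu> * (p \<bullet> v)\<^sup>2 \<ge> 0" by auto
      \<comment> \<open>The correction is the matrix \<open>w' p\<^sup>T\<close>. As
        \<open>p \<bullet> u = 1\<close>, the new graph passes through \<open>x\<close>.\<close>
      define Z where "Z = Z\<^sub>0 + mat l n (\<lambda>(i, j). w' $ i * p $ j)"
      have Z: "Z \<in> carrier_mat l n" using Z0 by (auto simp: Z_def)
      have Zv: "v @\<^sub>v Z *\<^sub>v v = E *\<^sub>v v + (p \<bullet> v) \<cdot>\<^sub>v d" if v: "v \<in> carrier_vec n" for v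
      proof -
        have "mat l n (\<lambda>(i, j). w' $ i * p $ j) *\<^sub>v v = (p \<bullet> v) \<cdot>\<^sub>v w'"
          by (rule eq_vecI) (use v p in \<open>auto simp: scalar_prod_def sum_distrib_left mult_ac\<close>)
        then have "Z *\<^sub>v v = Z\<^sub>0 *\<^sub>v v + (p \<bullet> v) \<cdot>\<^sub>v w'"
          using v by (simp add: Z_def mat_vec_simps)
        then show ?thesis
          unfolding Ev[OF v] d_def using v by (intro eq_vecI) auto
      qed
      have "\<forall>v\<in>carrier_vec n. (v @\<^sub>v Z *\<^sub>v v) \<bullet> (G *\<^sub>v (v @\<^sub>v Z *\<^sub>v v)) \<ge> 0"
        using psd_p by (simp add: Zv expand)
      from imp[OF Z this] have "(u @\<^sub>v Z *\<^sub>v u) \<bullet> (M *\<^sub>v (u @\<^sub>v Z *\<^sub>v u)) \<ge> 0" using uw by auto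
      then show ?thesis using Zv[OF uw(1)] p(2) xd by simp
    qed
  qed
  define u\<^sub>0 :: "real vec" where "u\<^sub>0 = unit_vec n 0"
  have u0: "u\<^sub>0 \<in> carrier_vec n" "u\<^sub>0 \<noteq> 0\<^sub>v n" using False by (auto simp: u\<^sub>0_def)
  show ?thesis
  proof (rule S_lemma[OF M G _ _ lift])
    show "E *\<^sub>v u\<^sub>0 \<in> carrier_vec (n + l)" using E u0 by auto
    show "(E *\<^sub>v u\<^sub>0) \<bullet> (G *\<^sub>v (E *\<^sub>v u\<^sub>0)) > 0"
      using R u0 Rv[OF u0(1)] by (auto simp: pd_def)
  qed
qed

section \<open>Inverses, block diagonals and Kronecker products\<close>

lemma minv_inverse:
  assumes A: "A \<in> carrier_mat k k" and det: "det A \<noteq> 0"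
  shows "minv A \<in> carrier_mat k k" "A * minv A = 1\<^sub>m k" "minv A * A = 1\<^sub>m k"
proof -
  have "A \<in> Units (ring_mat TYPE(real) k ())" by (rule det_non_zero_imp_unit[OF A det])
  then obtain C where C: "mat_inverse A = Some C"
    using mat_inverse(1)[OF A, of "()"] by (cases "mat_inverse A") auto
  then show "minv A \<in> carrier_mat k k" "A * minv A = 1\<^sub>m k" "minv A * A = 1\<^sub>m k"
    using mat_inverse(2)[OF A C] by (auto simp: minv_def)
qed

text \<open>A one-sided inverse suffices: multiplicativity of the determinant makes \<open>A\<close>
  invertible, and cancelling \<open>A\<close> identifies \<open>B\<close>.\<close>

lemma minv_eqI:
  assumes A: "A \<in> carrier_mat k k" and B: "B \<in> carrier_mat k k" and AB: "A * B = 1\<^sub>m k"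
  shows "minv A = B"
proof -
  have "det A * det B = 1" using det_mult[OF A B] AB by simp
  then have "det A \<noteq> 0" by auto
  note inv = minv_inverse[OF A this]
  have "minv A * (A * B) = (minv A * A) * B" using A B inv(1) by simp
  then show ?thesis using inv B AB by simp
qed

lemma pd_minv:
  assumes A: "A \<in> carrier_mat k k" and pd: "pd A"
  shows "minv A \<in> carrier_mat k k" "A * minv A = 1\<^sub>m k" "minv A * A = 1\<^sub>m k"
    "(minv A)\<^sup>T = minv A" "pd (minv A)"
proof -
  have sym: "A\<^sup>T = A" using pd by (simp add: pd_def)
  have "det A \<noteq> 0"
  proof
    assume "det A = 0"
    then obtain v where "v \<in> carrier_vec k" "v \<noteq> 0\<^sub>v k" "A *\<^sub>v v = 0\<^sub>v k"
      using det_0_iff_vec_prod_zero[OF A] by auto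
    then show False using pd A by (auto simp: pd_def)
  qed
  then show inv: "minv A \<in> carrier_mat k k" "A * minv A = 1\<^sub>m k" "minv A * A = 1\<^sub>m k"
    by (rule minv_inverse[OF A])+
  have "(minv A * A)\<^sup>T = A * (minv A)\<^sup>T" using transpose_mult[OF inv(1) A] sym by simp
  then have "A * (minv A)\<^sup>T = 1\<^sub>m k" using inv by simp
  then show sym_inv: "(minv A)\<^sup>T = minv A"
    using minv_eqI[OF A, of "(minv A)\<^sup>T"] inv by simp
  show "pd (minv A)"
    unfolding pd_def
  proof (intro conjI ballI impI)
    show "square_mat (minv A)" using inv by simp
    show "(minv A)\<^sup>T = minv A" by (rule sym_inv)
    fix v :: "real vec" assume "v \<in> carrier_vec (dim_row (minv A))" "v \<noteq> 0\<^sub>v (dim_row (minv A))"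
    then have v: "v \<in> carrier_vec k" "v \<noteq> 0\<^sub>v k" using inv by auto
    define w where "w = minv A *\<^sub>v v"
    have w: "w \<in> carrier_vec k" using inv v by (auto simp: w_def)
    have Aw: "A *\<^sub>v w = v"
      using assoc_mult_mat_vec[OF A inv(1) v(1)] inv(2) v by (simp add: w_def)
    then have "w \<noteq> 0\<^sub>v k" using v A by (auto simp: mat_vec_simps)
    then have "w \<bullet> (A *\<^sub>v w) > 0" using pd A w by (auto simp: pd_def)
    then show "v \<bullet> (minv A *\<^sub>v v) > 0"
      unfolding Aw w_def[symmetric] using scalar_prod_commute[of v w] v w by simp
  qed
qed

section \<open>Completing squares with a positive definite matrix\<close>

lemma minv_mult_cancel:
  assumes "A \<in> carrier_mat k k" "pd A" "v \<in> carrier_vec k"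
  shows "A *\<^sub>v (minv A *\<^sub>v v) = v" "minv A *\<^sub>v (A *\<^sub>v v) = v"
  using assoc_mult_mat_vec[OF assms(1) pd_minv(1)[OF assms(1,2)] assms(3)]
    assoc_mult_mat_vec[OF pd_minv(1)[OF assms(1,2)] assms(1,3)] pd_minv(2,3)[OF assms(1,2)] assms(3)
  by simp_all

text \<open>This is the Schur complement step in terms of vectors. As a function of \<open>b\<close>
  the left side has minimum 0, attained at \<open>b = - A y\<close>; the next two lemmas record the
  bound and the minimiser. It is used with \<open>Q\<close> and with the block diagonal matrix of
  the scaled \<open>P j\<close>.\<close>

lemma complete_square_minv:
  assumes A: "A \<in> carrier_mat k k" "pd A" and b: "b \<in> carrier_vec k" and y: "y \<in> carrier_vec k"
  shows "b \<bullet> (minv A *\<^sub>v b) + 2 * (b \<bullet> y) + y \<bullet> (A *\<^sub>v y) =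
    (b + A *\<^sub>v y) \<bullet> (minv A *\<^sub>v (b + A *\<^sub>v y))"
proof -
  note inv = pd_minv[OF A]
  note [simp] = carrier_matD[OF A(1)] carrier_matD[OF inv(1)] carrier_vecD[OF b] carrier_vecD[OF y]
  have "(A *\<^sub>v y) \<bullet> (minv A *\<^sub>v b) = b \<bullet> y"
    using scalar_prod_symmetric_mat[OF inv(4,1) _ b, of "A *\<^sub>v y"] A y
    by (simp add: minv_mult_cancel[OF A y])
  moreover have "(A *\<^sub>v y) \<bullet> y = y \<bullet> (A *\<^sub>v y)" by (rule scalar_prod_commute) simp
  ultimately show ?thesis
    by (simp add: mat_vec_simps minv_mult_cancel[OF A y])
qed

lemma complete_square_minv_nonneg:
  assumes A: "A \<in> carrier_mat k k" "pd A" and b: "b \<in> carrier_vec k" and y: "y \<in> carrier_vec k"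
  shows "b \<bullet> (minv A *\<^sub>v b) + 2 * (b \<bullet> y) + y \<bullet> (A *\<^sub>v y) \<ge> 0"
proof -
  have "b + A *\<^sub>v y \<in> carrier_vec k" using A b y by auto
  then show ?thesis
    unfolding complete_square_minv[OF assms] using pd_minv(1,5)[OF A]
    by (cases "b + A *\<^sub>v y = 0\<^sub>v k") (auto simp: pd_def mat_vec_simps less_imp_le)
qed

lemma complete_square_minv_zero:
  assumes A: "A \<in> carrier_mat k k" "pd A" and y: "y \<in> carrier_vec k"
  shows "(- (A *\<^sub>v y)) \<bullet> (minv A *\<^sub>v (- (A *\<^sub>v y))) + 2 * ((- (A *\<^sub>v y)) \<bullet> y) + y \<bullet> (A *\<^sub>v y) = 0"
proof -
  have Ay: "A *\<^sub>v y \<in> carrier_vec k" using A y by auto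
  then have "- (A *\<^sub>v y) + A *\<^sub>v y = 0\<^sub>v k" by (intro eq_vecI) auto
  then show ?thesis
    using complete_square_minv[OF A _ y, of "- (A *\<^sub>v y)"] Ay pd_minv(1)[OF A]
    by (simp add: mat_vec_simps)
qed

lemma psd_congruence_iff:
  assumes F: "F \<in> carrier_mat k k" "F\<^sup>T = F" and V: "V \<in> carrier_mat k n"
  shows "psd (V\<^sup>T * F * V) \<longleftrightarrow> (\<forall>v\<in>carrier_vec n. (V *\<^sub>v v) \<bullet> (F *\<^sub>v (V *\<^sub>v v)) \<ge> 0)"
proof -
  note [simp] = carrier_matD[OF F(1)] carrier_matD[OF V]
  have form: "v \<bullet> ((V\<^sup>T * F * V) *\<^sub>v w) = (V *\<^sub>v v) \<bullet> (F *\<^sub>v (V *\<^sub>v w))"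
    if "v \<in> carrier_vec n" "w \<in> carrier_vec n" for v w
    using carrier_vecD[OF that(1)] carrier_vecD[OF that(2)] by (simp add: mat_vec_simps)
  have "(V\<^sup>T * F * V)\<^sup>T = V\<^sup>T * F * V"
    by (rule symmetric_matI[of _ n])
      (use V in \<open>auto simp: form intro!: carrier_matI scalar_prod_symmetric_mat[OF F(2,1)]\<close>)
  then show ?thesis by (auto simp: psd_def form)
qed

section \<open>Block diagonal matrices, stacked vectors and sums of matrices\<close>

lemma pd_diag_four_block:
  assumes A: "A \<in> carrier_mat k k" "pd A" and B: "B \<in> carrier_mat l l" "pd B"
  shows "pd (four_block_mat A (0\<^sub>m k l) (0\<^sub>m l k) B)" (is "pd ?M")
proof -
  have M: "?M \<in> carrier_mat (k + l) (k + l)" using A B by auto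
  have "?M\<^sup>T = ?M"
    using A B by (subst transpose_four_block_mat[of _ k k _ l _ l]) (auto simp: pd_def)
  moreover have "v \<bullet> (?M *\<^sub>v v) > 0" if v: "v \<in> carrier_vec (k + l)" "v \<noteq> 0\<^sub>v (k + l)" for v
  proof -
    define a where "a = vec_first v k"
    define b where "b = vec_last v l"
    have ab: "a \<in> carrier_vec k" "b \<in> carrier_vec l" "v = a @\<^sub>v b" using v by (auto simp: a_def b_def)
    note [simp] = carrier_vecD[OF ab(1)] carrier_vecD[OF ab(2)] carrier_matD[OF A(1)] carrier_matD[OF B(1)]
    have "?M *\<^sub>v v = (A *\<^sub>v a) @\<^sub>v (B *\<^sub>v b)"
      unfolding ab(3) using A B ab
      by (subst four_block_mat_mult_vec[of _ k k _ l _ l]) (auto simp: mat_vec_simps)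
    then have eq: "v \<bullet> (?M *\<^sub>v v) = a \<bullet> (A *\<^sub>v a) + b \<bullet> (B *\<^sub>v b)"
      unfolding ab(3) by (simp add: mat_vec_simps)
    have "a \<noteq> 0\<^sub>v k \<or> b \<noteq> 0\<^sub>v l" using v ab(3) by auto
    moreover have "a \<noteq> 0\<^sub>v k \<Longrightarrow> a \<bullet> (A *\<^sub>v a) > 0" "b \<noteq> 0\<^sub>v l \<Longrightarrow> b \<bullet> (B *\<^sub>v b) > 0"
      using A B ab by (auto simp: pd_def)
    ultimately show ?thesis
      unfolding eq by (cases "a = 0\<^sub>v k"; cases "b = 0\<^sub>v l") (auto simp: mat_vec_simps add_pos_pos)
  qed
  ultimately show ?thesis using carrier_matD[OF M] by (simp only: pd_def square_mat.simps) blast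
qed

lemma diag_block_mat_map_carrier:
  assumes "\<And>j. j \<in> set js \<Longrightarrow> F j \<in> carrier_mat n n"
  shows "diag_block_mat (map F js) \<in> carrier_mat (length js * n) (length js * n)"
  using assms by (induction js) (auto simp: Let_def)

lemma pd_diag_block_mat:
  assumes "\<And>j. j \<in> set js \<Longrightarrow> F j \<in> carrier_mat n n" "\<And>j. j \<in> set js \<Longrightarrow> pd (F j)"
  shows "pd (diag_block_mat (map F js))"
  using assms
proof (induction js)
  case Nil
  then show ?case by (auto simp: pd_def)
next
  case (Cons j js)
  have car: "F j \<in> carrier_mat n n" using Cons by simp
  have car': "diag_block_mat (map F js) \<in> carrier_mat (length js * n) (length js * n)"
    using Cons by (intro diag_block_mat_map_carrier) auto
  from pd_diag_four_block[OF car _ car'] Cons carrier_matD[OF car] carrier_matD[OF car']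
  show ?case by (simp add: Let_def)
qed

lemma diag_block_mat_mult:
  fixes F H :: "'i \<Rightarrow> 'a :: semiring_0 mat"
  assumes "\<And>j. j \<in> set js \<Longrightarrow> F j \<in> carrier_mat n n" "\<And>j. j \<in> set js \<Longrightarrow> H j \<in> carrier_mat n n"
  shows "diag_block_mat (map F js) * diag_block_mat (map H js) =
    diag_block_mat (map (\<lambda>j. F j * H j) js)"
  using assms
proof (induction js)
  case (Cons j js)
  let ?l = "length js * n"
  have car: "F j \<in> carrier_mat n n" "H j \<in> carrier_mat n n" using Cons by auto
  have car': "diag_block_mat (map F js) \<in> carrier_mat ?l ?l" "diag_block_mat (map H js) \<in> carrier_mat ?l ?l"
    using Cons by (auto intro!: diag_block_mat_map_carrier)
  have IH: "diag_block_mat (map F js) * diag_block_mat (map H js) =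
    diag_block_mat (map (\<lambda>j. F j * H j) js)" using Cons by simp
  note [simp] = carrier_matD[OF car(1)] carrier_matD[OF car(2)]
    carrier_matD[OF car'(1)] carrier_matD[OF car'(2)]
  have dims: "dim_row (diag_block_mat (map (\<lambda>j. F j * H j) js)) = ?l"
    "dim_col (diag_block_mat (map (\<lambda>j. F j * H j) js)) = ?l" by (auto simp flip: IH)
  show ?case
    using car car'
    by (simp add: Let_def dims mult_four_block_mat[OF car(1) zero_carrier_mat zero_carrier_mat car'(1)
          car(2) zero_carrier_mat zero_carrier_mat car'(2)] IH flip: IH)
qed auto

text \<open>The product stacks \<open>k\<close> copies of \<open>x\<close>. The explicit index
  \<open>i mod n\<close> lets inductions over the blocks split off one copy at a time.\<close>

lemma kronecker_ones_mult_vec: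
  assumes "x \<in> carrier_vec n"
  shows "(ones_col k \<otimes>\<^sub>m 1\<^sub>m n) *\<^sub>v x = vec (k * n) (\<lambda>i. x $ (i mod n))"
proof (rule eq_vecI)
  fix i assume "i < dim_vec (vec (k * n) (\<lambda>i. x $ (i mod n)))"
  then have i: "i < k * n" by simp
  then have n: "n > 0" by (cases n) auto
  then have mod: "i mod n < n" and div: "i div n < k"
    using i by (auto simp: less_mult_imp_div_less)
  have "((ones_col k \<otimes>\<^sub>m 1\<^sub>m n) *\<^sub>v x) $ i =
      (\<Sum>j = 0..<n. (if i mod n = j then 1 else 0) * x $ j)"
    using assms i mod div
    by (auto simp: kronecker_def ones_col_def scalar_prod_def intro!: sum.cong)
  also have "\<dots> = x $ (i mod n)" using mod by (simp add: if_distrib if_distribR cong: if_cong)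
  finally show "((ones_col k \<otimes>\<^sub>m 1\<^sub>m n) *\<^sub>v x) $ i = vec (k * n) (\<lambda>i. x $ (i mod n)) $ i"
    using i by simp
qed (simp add: kronecker_def ones_col_def)

text \<open>Each diagonal block meets its own copy of \<open>x\<close>. This is how the sum over the
  modes other than \<open>i\<close> is encoded in a single block of the linear matrix
  inequality.\<close>

lemma kronecker_ones_quadratic_form:
  assumes "\<And>j. j \<in> set js \<Longrightarrow> F j \<in> carrier_mat n n" and x: "x \<in> carrier_vec n"
  defines "e \<equiv> (ones_col (length js) \<otimes>\<^sub>m 1\<^sub>m n) *\<^sub>v x"
  shows "e \<bullet> (diag_block_mat (map F js) *\<^sub>v e) = (\<Sum>j\<leftarrow>js. x \<bullet> (F j *\<^sub>v x))"
  unfolding e_def kronecker_ones_mult_vec[OF x] using assms(1)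
proof (induction js)
  case (Cons j js)
  let ?l = "length js * n" and ?v = "\<lambda>k. vec (k * n) (\<lambda>i. x $ (i mod n))"
  have car: "F j \<in> carrier_mat n n" using Cons by simp
  have car': "diag_block_mat (map F js) \<in> carrier_mat ?l ?l"
    using Cons by (intro diag_block_mat_map_carrier) auto
  have split: "?v (length (j # js)) = x @\<^sub>v ?v (length js)"
    by (rule eq_vecI) (use x in \<open>auto simp: le_mod_geq\<close>)
  have v: "?v (length js) \<in> carrier_vec ?l" by simp
  show ?case
    unfolding split using Cons x car car'
    by (simp add: Let_def four_block_mat_mult_vec[OF car zero_carrier_mat zero_carrier_mat car' x v]
        mat_vec_simps carrier_vecD[OF x] carrier_matD[OF car] carrier_matD[OF car'])
qed (simp add: mat_vec_simps)

lemma mat_sum_carrier [simp]: "mat_sum r c F J \<in> carrier_mat r c"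
  by (simp add: mat_sum_def)

lemma mat_sum_quadratic_form:
  assumes "finite J" "\<And>j. j \<in> J \<Longrightarrow> F j \<in> carrier_mat n n" and x: "x \<in> carrier_vec n"
  shows "x \<bullet> (mat_sum n n F J *\<^sub>v x) = (\<Sum>j\<in>J. x \<bullet> (F j *\<^sub>v x))"
  using assms(1,2)
proof (induction J)
  case empty
  have "mat_sum n n F {} = 0\<^sub>m n n" by (auto simp: mat_sum_def)
  then show ?case using x by (simp add: mat_vec_simps)
next
  case (insert j J)
  have car: "F j \<in> carrier_mat n n" using insert by simp
  have "mat_sum n n F (insert j J) = F j + mat_sum n n F J"
    using car insert by (intro eq_matI) (auto simp: mat_sum_def)
  then show ?case
    using insert.IH insert.prems insert.hyps carrier_vecD[OF x] carrier_matD[OF car]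
      carrier_matD[OF mat_sum_carrier[of n n F J]] by (simp add: mat_vec_simps)
qed

lemma transpose_mat_sum:
  assumes "\<And>j. j \<in> J \<Longrightarrow> F j \<in> carrier_mat n n" "\<And>j. j \<in> J \<Longrightarrow> (F j)\<^sup>T = F j"
  shows "(mat_sum n n F J)\<^sup>T = mat_sum n n F J"
proof (rule eq_matI)
  have "F j $$ (b, a) = F j $$ (a, b)" if "j \<in> J" "a < n" "b < n" for j a b
    using arg_cong[OF assms(2)[OF that(1)], of "\<lambda>A. A $$ (a, b)"] assms(1)[OF that(1)] that by simp
  then show "(mat_sum n n F J)\<^sup>T $$ (a, b) = mat_sum n n F J $$ (a, b)"
    if "a < dim_row (mat_sum n n F J)" "b < dim_col (mat_sum n n F J)" for a b
    using that by (auto simp: mat_sum_def intro!: sum.cong)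
qed (auto simp: mat_sum_def)

section \<open>The compatibility set and the linear matrix inequality\<close>

text \<open>The form \<open>f\<close>, used with \<open>\<Psi> = \<Sum>\<^sub>j \<pi>\<^sub>j\<^sub>i P\<^sub>j + Q\<close>, \<open>S = P\<^sub>i\<^sup>-\<^sup>1\<close> and \<open>L = K\<^sub>i S\<close>. For \<open>v = S u\<close>,
  \<open>w = A\<^sup>T u\<close> and \<open>z = B\<^sup>T u\<close> its value is minus the Lyapunov form of the closed loop at \<open>v\<close>.\<close>

definition lyapunov_form ::
  "real mat \<Rightarrow> real mat \<Rightarrow> real mat \<Rightarrow> real vec \<Rightarrow> real vec \<Rightarrow> real vec \<Rightarrow> real" where
  "lyapunov_form \<Psi> S L u w z =
    - ((S *\<^sub>v u) \<bullet> (\<Psi> *\<^sub>v (S *\<^sub>v u))) - 2 * ((S *\<^sub>v u) \<bullet> w) - 2 * ((L *\<^sub>v u) \<bullet> z)"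

text \<open>The data of one mode with the mode index dropped. The blocks of \<open>\<Phi>\<close>
  are kept as parameters so that the sign of \<open>\<Phi>22\<close> is available.\<close>

locale noisy_data =
  fixes n m T :: nat and \<Phi> \<Phi>11 \<Phi>12 \<Phi>22 Xd X U :: "real mat"
  assumes Xd: "Xd \<in> carrier_mat n T" and X: "X \<in> carrier_mat n T" and U: "U \<in> carrier_mat m T"
    and \<Phi>11: "\<Phi>11 \<in> carrier_mat n n" and \<Phi>12: "\<Phi>12 \<in> carrier_mat n T"
    and \<Phi>22: "\<Phi>22 \<in> carrier_mat T T"
    and \<Phi>_eq: "\<Phi> = block_mat [[\<Phi>11, \<Phi>12], [\<Phi>12\<^sup>T, \<Phi>22]]"
    and \<Phi>_sym: "\<Phi>\<^sup>T = \<Phi>"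
    and \<Phi>22_nd: "nd \<Phi>22"
begin

lemma dims [simp]:
  "dim_row Xd = n" "dim_col Xd = T" "dim_row X = n" "dim_col X = T" "dim_row U = m" "dim_col U = T"
  "dim_row \<Phi>11 = n" "dim_col \<Phi>11 = n" "dim_row \<Phi>12 = n" "dim_col \<Phi>12 = T"
  "dim_row \<Phi>22 = T" "dim_col \<Phi>22 = T"
  using Xd X U \<Phi>11 \<Phi>12 \<Phi>22 by auto

lemma \<Phi>_dims [simp]: "dim_row \<Phi> = n + T" "dim_col \<Phi> = n + T"
  by (simp_all add: \<Phi>_eq block_mat_def)

lemma \<Phi>_carrier: "\<Phi> \<in> carrier_mat (n + T) (n + T)"
  by (rule carrier_matI) simp_all

text \<open>For \<open>w = A\<^sup>T u\<close> and \<open>z = B\<^sup>T u\<close> this is \<open>W\<^sup>T u\<close> with \<open>W = Xd - A X - B U\<close>, the only noise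
  matrix that explains the data by \<open>(A, B)\<close>.\<close>

definition residual :: "real vec \<Rightarrow> real vec \<Rightarrow> real vec \<Rightarrow> real vec" where
  "residual u w z = Xd\<^sup>T *\<^sub>v u - X\<^sup>T *\<^sub>v w - U\<^sup>T *\<^sub>v z"

lemma dim_residual [simp]: "dim_vec (residual u w z) = T"
  by (simp add: residual_def)

text \<open>The form \<open>g\<close> of the overview. For \<open>w = A\<^sup>T u\<close> and
  \<open>z = B\<^sup>T u\<close> it is the value at \<open>u\<close> of the form defining
  \<open>noise_set\<close> at the residual noise matrix.\<close>

definition noise_form :: "real vec \<Rightarrow> real vec \<Rightarrow> real vec \<Rightarrow> real" where
  "noise_form u w z = (u @\<^sub>v residual u w z) \<bullet> (\<Phi> *\<^sub>v (u @\<^sub>v residual u w z))"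

text \<open>The two zero block rows of \<open>Gamma_mat\<close> discard \<open>a\<close> and
  \<open>b\<close>, and the other three assemble the residual. Hence the term subtracted in the
  linear matrix inequality contributes a multiple of \<open>noise_form\<close>.\<close>

lemma Gamma_transpose_mult:
  assumes "dim_vec a = n" "dim_vec b = (N - 1) * n" "dim_vec u = n" "dim_vec w = n" "dim_vec z = m"
  shows "(Gamma_mat N n m T Xd X U)\<^sup>T *\<^sub>v (a @\<^sub>v b @\<^sub>v u @\<^sub>v w @\<^sub>v z) = u @\<^sub>v residual u w z"
proof -
  have "(Gamma_mat N n m T Xd X U)\<^sup>T *\<^sub>v (a @\<^sub>v b @\<^sub>v u @\<^sub>v w @\<^sub>v z) =
      (0\<^sub>v n + (0\<^sub>v n + (u + (0\<^sub>v n + 0\<^sub>v n)))) @\<^sub>v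
      (0\<^sub>v T + (0\<^sub>v T + (Xd\<^sup>T *\<^sub>v u + (- (X\<^sup>T *\<^sub>v w) + - (U\<^sup>T *\<^sub>v z)))))"
    using assms
    by (simp add: Gamma_mat_def block_mat_def transpose_append_rows transpose_append_cols
        transpose_uminus mat_vec_simps)
  also have "\<dots> = u @\<^sub>v residual u w z"
    using assms by (intro arg_cong2[where f = append_vec] eq_vecI) (auto simp: residual_def)
  finally show ?thesis .
qed

lemma Gamma_dims [simp]:
  "dim_row (Gamma_mat N n m T Xd X U) = n + ((N - 1) * n + (n + (n + m)))"
  "dim_col (Gamma_mat N n m T Xd X U) = n + T"
  by (simp_all add: Gamma_mat_def block_mat_def)

text \<open>The outer factor of \<open>H_mat\<close>, which is \<open>Gamma_mat\<close> without its
  two zero block rows.\<close>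

definition data_block :: "real mat" where
  "data_block = block_mat [[1\<^sub>m n, Xd], [0\<^sub>m n n, - X], [0\<^sub>m m n, - U]]"

lemma data_block_dims [simp]:
  "dim_row data_block = n + (n + m)" "dim_col data_block = n + T"
  by (simp_all add: data_block_def block_mat_def)

lemma H_mat_eq: "H_mat n m \<Phi> Xd X U = data_block * \<Phi> * data_block\<^sup>T"
  by (simp add: H_mat_def data_block_def Let_def)

lemma H_carrier: "H_mat n m \<Phi> Xd X U \<in> carrier_mat (n + (n + m)) (n + (n + m))"
  by (rule carrier_matI) (simp_all add: H_mat_eq)

lemma data_block_transpose_mult:
  assumes "dim_vec u = n" "dim_vec w = n" "dim_vec z = m"
  shows "data_block\<^sup>T *\<^sub>v (u @\<^sub>v w @\<^sub>v z) = u @\<^sub>v residual u w z"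
proof -
  have "data_block\<^sup>T *\<^sub>v (u @\<^sub>v w @\<^sub>v z) =
      (u + (0\<^sub>v n + 0\<^sub>v n)) @\<^sub>v (Xd\<^sup>T *\<^sub>v u + (- (X\<^sup>T *\<^sub>v w) + - (U\<^sup>T *\<^sub>v z)))"
    using assms
    by (simp add: data_block_def block_mat_def transpose_append_rows transpose_append_cols
        transpose_uminus mat_vec_simps)
  also have "\<dots> = u @\<^sub>v residual u w z"
    using assms by (intro arg_cong2[where f = append_vec] eq_vecI) (auto simp: residual_def)
  finally show ?thesis .
qed

lemma H_mult:
  assumes "dim_vec u = n" "dim_vec w = n" "dim_vec z = m"
  shows "H_mat n m \<Phi> Xd X U *\<^sub>v (u @\<^sub>v w @\<^sub>v z) = data_block *\<^sub>v (\<Phi> *\<^sub>v (u @\<^sub>v residual u w z))"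
  using assms by (simp add: H_mat_eq mat_vec_simps flip: data_block_transpose_mult)

lemma H_form:
  assumes "dim_vec u = n" "dim_vec w = n" "dim_vec z = m"
  shows "(u @\<^sub>v w @\<^sub>v z) \<bullet> (H_mat n m \<Phi> Xd X U *\<^sub>v (u @\<^sub>v w @\<^sub>v z)) = noise_form u w z"
  using assms
    scalar_prod_transpose_mult[of data_block "u @\<^sub>v w @\<^sub>v z" "\<Phi> *\<^sub>v (u @\<^sub>v residual u w z)"]
  by (simp add: H_mult noise_form_def data_block_transpose_mult)

lemma H_sym: "(H_mat n m \<Phi> Xd X U)\<^sup>T = H_mat n m \<Phi> Xd X U"
proof (rule symmetric_matI[OF H_carrier])
  fix x y :: "real vec" assume xy: "x \<in> carrier_vec (n + (n + m))" "y \<in> carrier_vec (n + (n + m))"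
  have "data_block\<^sup>T *\<^sub>v x \<in> carrier_vec (n + T)" "data_block\<^sup>T *\<^sub>v y \<in> carrier_vec (n + T)"
    by (auto intro!: carrier_vecI)
  with xy show "x \<bullet> (H_mat n m \<Phi> Xd X U *\<^sub>v y) = y \<bullet> (H_mat n m \<Phi> Xd X U *\<^sub>v x)"
    using scalar_prod_transpose_mult[of data_block x "\<Phi> *\<^sub>v (data_block\<^sup>T *\<^sub>v y)"]
      scalar_prod_transpose_mult[of data_block y "\<Phi> *\<^sub>v (data_block\<^sup>T *\<^sub>v x)"]
      scalar_prod_symmetric_mat[OF \<Phi>_sym \<Phi>_carrier, of "data_block\<^sup>T *\<^sub>v x" "data_block\<^sup>T *\<^sub>v y"]
    by (simp add: H_mat_eq mat_mult_vec_assoc)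
qed

lemma zero_append_\<Phi>_form:
  assumes "dim_vec r = T"
  shows "(0\<^sub>v n @\<^sub>v r) \<bullet> (\<Phi> *\<^sub>v (0\<^sub>v n @\<^sub>v r)) = r \<bullet> (\<Phi>22 *\<^sub>v r)"
  using assms by (simp add: \<Phi>_eq block_mat_def mat_vec_simps)

lemma \<Phi>22_form_neg:
  assumes "dim_vec r = T" "r \<noteq> 0\<^sub>v T"
  shows "r \<bullet> (\<Phi>22 *\<^sub>v r) < 0"
  using \<Phi>22_nd assms carrier_vecI[OF assms(1)] by (auto simp: nd_def pd_def)

text \<open>For \<open>u = 0\<close> only the block \<open>\<Phi>22\<close> acts on the residual,
  and it is negative definite.\<close>

lemma noise_form_zero_nonpos:
  assumes "dim_vec w = n" "dim_vec z = m"
  shows "noise_form (0\<^sub>v n) w z \<le> 0"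
  using \<Phi>22_form_neg[of "residual (0\<^sub>v n) w z"]
  by (cases "residual (0\<^sub>v n) w z = 0\<^sub>v T")
    (auto simp: noise_form_def zero_append_\<Phi>_form mat_vec_simps)

text \<open>Definiteness of \<open>\<Phi>22\<close> forces the residual to vanish, and
  \<open>H_mat\<close> acts on a vector only through \<open>u\<close> and the residual. This
  supplies the kernel condition of \<open>matrix_S_lemma\<close>.\<close>

lemma noise_form_zero_kernel:
  assumes "dim_vec w = n" "dim_vec z = m" "noise_form (0\<^sub>v n) w z = 0"
  shows "H_mat n m \<Phi> Xd X U *\<^sub>v (0\<^sub>v n @\<^sub>v w @\<^sub>v z) = 0\<^sub>v (n + (n + m))"
proof -
  have "residual (0\<^sub>v n) w z = 0\<^sub>v T"
    using \<Phi>22_form_neg[of "residual (0\<^sub>v n) w z"] assms(3)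
    by (force simp: noise_form_def zero_append_\<Phi>_form)
  moreover have "0\<^sub>v n @\<^sub>v 0\<^sub>v T = (0\<^sub>v (n + T) :: real vec)" by (intro eq_vecI) auto
  ultimately show ?thesis using assms by (simp add: H_mult mat_vec_simps)
qed

text \<open>The data equation determines the noise as \<open>W = Xd - A X - B U\<close>, so the
  existential quantifier collapses to one membership in \<open>noise_set\<close>. Then
  \<open>W\<^sup>T u\<close> is the residual at \<open>A\<^sup>T u\<close> and
  \<open>B\<^sup>T u\<close>.\<close>

lemma compat_set_iff:
  "(A, B) \<in> compat_set n m T \<Phi> Xd X U \<longleftrightarrow> A \<in> carrier_mat n n \<and> B \<in> carrier_mat n m \<and>
    (\<forall>u\<in>carrier_vec n. noise_form u (A\<^sup>T *\<^sub>v u) (B\<^sup>T *\<^sub>v u) \<ge> 0)"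
proof (cases "A \<in> carrier_mat n n \<and> B \<in> carrier_mat n m")
  case True
  then have A: "A \<in> carrier_mat n n" and B: "B \<in> carrier_mat n m" by auto
  note [simp] = carrier_matD[OF A] carrier_matD[OF B]
  define W where "W = Xd - A * X - B * U"
  have W: "W \<in> carrier_mat n T" by (auto simp: W_def intro!: carrier_matI)
  note [simp] = carrier_matD[OF W]
  have "Xd = A * X + B * U + V \<longleftrightarrow> V = W" if "V \<in> carrier_mat n T" for V
  proof
    assume eq: "Xd = A * X + B * U + V"
    show "V = W" unfolding W_def by (subst eq) (rule eq_matI, use that in auto)
  next
    assume "V = W"
    then show "Xd = A * X + B * U + V" by (intro eq_matI) (auto simp: W_def)
  qed
  then have "(A, B) \<in> compat_set n m T \<Phi> Xd X U \<longleftrightarrow> W \<in> noise_set n T \<Phi>"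
    using A B W by (auto simp: compat_set_def noise_set_def)
  also have "\<dots> \<longleftrightarrow> psd ((1\<^sub>m n @\<^sub>r W\<^sup>T)\<^sup>T * \<Phi> * (1\<^sub>m n @\<^sub>r W\<^sup>T))"
    using W by (simp add: noise_set_def block_mat_def)
  also have "\<dots> \<longleftrightarrow> (\<forall>u\<in>carrier_vec n. noise_form u (A\<^sup>T *\<^sub>v u) (B\<^sup>T *\<^sub>v u) \<ge> 0)"
  proof (subst psd_congruence_iff[OF \<Phi>_carrier \<Phi>_sym, of _ n])
    have "(1\<^sub>m n @\<^sub>r W\<^sup>T) *\<^sub>v u = u @\<^sub>v residual u (A\<^sup>T *\<^sub>v u) (B\<^sup>T *\<^sub>v u)"
      if u: "u \<in> carrier_vec n" for u
    proof -
      have "W\<^sup>T = Xd\<^sup>T - X\<^sup>T * A\<^sup>T - U\<^sup>T * B\<^sup>T"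
        unfolding W_def using A B Xd X U
        by (simp add: transpose_minus[of _ n T] transpose_mult[of _ n n _ T] transpose_mult[of _ n m _ T]
            minus_carrier_mat)
      then show ?thesis
        using u by (simp add: residual_def mat_vec_simps)
    qed
    then show "(\<forall>v\<in>carrier_vec n. 0 \<le> ((1\<^sub>m n @\<^sub>r W\<^sup>T) *\<^sub>v v) \<bullet> (\<Phi> *\<^sub>v ((1\<^sub>m n @\<^sub>r W\<^sup>T) *\<^sub>v v))) \<longleftrightarrow>
        (\<forall>u\<in>carrier_vec n. 0 \<le> noise_form u (A\<^sup>T *\<^sub>v u) (B\<^sup>T *\<^sub>v u))"
      by (simp add: noise_form_def)
  qed (auto intro!: carrier_matI)
  finally show ?thesis using A B by simp
qed (auto simp: compat_set_def)

text \<open>An instance of \<open>matrix_S_lemma\<close>: \<open>lyapunov_form\<close> is the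
  quadratic form of a block matrix \<open>M\<close> that vanishes for \<open>u = 0\<close>, and a
  graph over \<open>u\<close> corresponds to a pair \<open>(A, B)\<close> by stacking the
  transposes.\<close>

lemma S_procedure:
  assumes slater: "slater n m (H_mat n m \<Phi> Xd X U)"
    and \<Psi>: "\<Psi> \<in> carrier_mat n n" "\<Psi>\<^sup>T = \<Psi>" and S: "S \<in> carrier_mat n n" "S\<^sup>T = S"
    and L: "L \<in> carrier_mat m n"
    and imp: "\<And>A B. A \<in> carrier_mat n n \<Longrightarrow> B \<in> carrier_mat n m \<Longrightarrow>
      \<forall>u\<in>carrier_vec n. noise_form u (A\<^sup>T *\<^sub>v u) (B\<^sup>T *\<^sub>v u) \<ge> 0 \<Longrightarrow>
      \<forall>u\<in>carrier_vec n. lyapunov_form \<Psi> S L u (A\<^sup>T *\<^sub>v u) (B\<^sup>T *\<^sub>v u) \<ge> 0"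
  shows "\<exists>\<alpha>\<ge>0. \<forall>u\<in>carrier_vec n. \<forall>w\<in>carrier_vec n. \<forall>z\<in>carrier_vec m.
      lyapunov_form \<Psi> S L u w z \<ge> \<alpha> * noise_form u w z"
proof -
  note [simp] = carrier_matD[OF \<Psi>(1)] carrier_matD[OF S(1)] carrier_matD[OF L]
  define M where "M = block_mat
    [[- (S * \<Psi> * S), - S, - L\<^sup>T], [- S, 0\<^sub>m n n, 0\<^sub>m n m], [- L, 0\<^sub>m m n, 0\<^sub>m m m]]"
  have M: "M \<in> carrier_mat (n + (n + m)) (n + (n + m))"
    by (rule carrier_matI) (simp_all add: M_def block_mat_def)
  have split: "\<exists>u w z. dim_vec u = n \<and> dim_vec w = n \<and> dim_vec z = m \<and> x = u @\<^sub>v w @\<^sub>v z"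
    if "x \<in> carrier_vec (n + (n + m))" for x :: "real vec"
  proof -
    have "x = vec_first x n @\<^sub>v vec_first (vec_last x (n + m)) n @\<^sub>v vec_last (vec_last x (n + m)) m"
      using that by simp
    then show ?thesis by (metis dim_vec_first dim_vec_last)
  qed
  have Scomm: "v \<bullet> (S *\<^sub>v y) = (S *\<^sub>v v) \<bullet> y" if "dim_vec v = n" "dim_vec y = n" for v y
    using scalar_prod_mult_transpose[of S y v] that S(2) by simp
  have bilinear: "(u @\<^sub>v w @\<^sub>v z) \<bullet> (M *\<^sub>v (u' @\<^sub>v w' @\<^sub>v z')) =
      - ((S *\<^sub>v u) \<bullet> (\<Psi> *\<^sub>v (S *\<^sub>v u'))) - (S *\<^sub>v u) \<bullet> w' - (L *\<^sub>v u) \<bullet> z' - w \<bullet> (S *\<^sub>v u') - z \<bullet> (L *\<^sub>v u')"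
    if "dim_vec u = n" "dim_vec w = n" "dim_vec z = m" "dim_vec u' = n" "dim_vec w' = n" "dim_vec z' = m"
    for u w z u' w' z'
    using that by (simp add: M_def block_mat_def mat_vec_simps Scomm[of u])
  have quadratic: "(u @\<^sub>v w @\<^sub>v z) \<bullet> (M *\<^sub>v (u @\<^sub>v w @\<^sub>v z)) = lyapunov_form \<Psi> S L u w z"
    if "dim_vec u = n" "dim_vec w = n" "dim_vec z = m" for u w z
    using bilinear[OF that that] scalar_prod_commute[of w "S *\<^sub>v u"] scalar_prod_commute[of z "L *\<^sub>v u"] that
    by (simp add: lyapunov_form_def)
  have M_sym: "M\<^sup>T = M"
  proof (rule symmetric_matI[OF M])
    fix x y :: "real vec"
    assume "x \<in> carrier_vec (n + (n + m))" "y \<in> carrier_vec (n + (n + m))"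
    then obtain u w z u' w' z' where *: "dim_vec u = n" "dim_vec w = n" "dim_vec z = m" "x = u @\<^sub>v w @\<^sub>v z"
      "dim_vec u' = n" "dim_vec w' = n" "dim_vec z' = m" "y = u' @\<^sub>v w' @\<^sub>v z'"
      using split by meson
    have "(S *\<^sub>v u) \<bullet> (\<Psi> *\<^sub>v (S *\<^sub>v u')) = (S *\<^sub>v u') \<bullet> (\<Psi> *\<^sub>v (S *\<^sub>v u))"
      by (rule scalar_prod_symmetric_mat[OF \<Psi>(2,1)]) (auto intro!: carrier_vecI)
    then show "x \<bullet> (M *\<^sub>v y) = y \<bullet> (M *\<^sub>v x)"
      using * bilinear[of u w z u' w' z'] bilinear[of u' w' z' u w z]
        scalar_prod_commute[of "S *\<^sub>v u" w'] scalar_prod_commute[of "L *\<^sub>v u" z']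
        scalar_prod_commute[of "S *\<^sub>v u'" w] scalar_prod_commute[of "L *\<^sub>v u'" z]
      by simp
  qed
  have split2: "\<exists>w z. dim_vec w = n \<and> dim_vec z = m \<and> y = w @\<^sub>v z" if "y \<in> carrier_vec (n + m)"
    for y :: "real vec"
    using that vec_first_last_append[of y n m] by (metis dim_vec_first dim_vec_last)
  obtain Z\<^sub>0 where Z0: "Z\<^sub>0 \<in> carrier_mat (n + m) n"
    "pd (block_mat [[1\<^sub>m n, Z\<^sub>0\<^sup>T]] * H_mat n m \<Phi> Xd X U * (block_mat [[1\<^sub>m n, Z\<^sub>0\<^sup>T]])\<^sup>T)"
    using slater by (auto simp: slater_def)
  \<comment> \<open>The Slater condition is stated with the row \<open>[I, Z\<^sup>T]\<close>; the
    S-lemma expects the column with blocks \<open>I\<close> and \<open>Z\<close>.\<close>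
  have "block_mat [[1\<^sub>m n, Z\<^sub>0\<^sup>T]] = (1\<^sub>m n @\<^sub>r Z\<^sub>0)\<^sup>T"
    using Z0(1) by (simp add: block_mat_def transpose_append_rows)
  then have Z0_pd: "pd ((1\<^sub>m n @\<^sub>r Z\<^sub>0)\<^sup>T * H_mat n m \<Phi> Xd X U * (1\<^sub>m n @\<^sub>r Z\<^sub>0))"
    using Z0(2) by simp
  have "\<exists>\<alpha>\<ge>0. \<forall>x\<in>carrier_vec (n + (n + m)). x \<bullet> (M *\<^sub>v x) \<ge> \<alpha> * (x \<bullet> (H_mat n m \<Phi> Xd X U *\<^sub>v x))"
  proof (rule matrix_S_lemma[OF M M_sym H_carrier H_sym _ _ _ Z0(1) Z0_pd])
    fix y :: "real vec" assume "y \<in> carrier_vec (n + m)"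
    then obtain w z where y: "dim_vec w = n" "dim_vec z = m" "y = w @\<^sub>v z" using split2 by blast
    show "(0\<^sub>v n @\<^sub>v y) \<bullet> (M *\<^sub>v (0\<^sub>v n @\<^sub>v y)) \<ge> 0"
      using y by (simp add: quadratic lyapunov_form_def mat_vec_simps)
    show "(0\<^sub>v n @\<^sub>v y) \<bullet> (H_mat n m \<Phi> Xd X U *\<^sub>v (0\<^sub>v n @\<^sub>v y)) \<le> 0"
      using y by (simp add: H_form noise_form_zero_nonpos)
    show "H_mat n m \<Phi> Xd X U *\<^sub>v (0\<^sub>v n @\<^sub>v y) = 0\<^sub>v (n + (n + m))"
      if "(0\<^sub>v n @\<^sub>v y) \<bullet> (H_mat n m \<Phi> Xd X U *\<^sub>v (0\<^sub>v n @\<^sub>v y)) = 0"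
      using y that by (simp add: H_form noise_form_zero_kernel)
  next
    fix Z :: "real mat"
    assume Z: "Z \<in> carrier_mat (n + m) n"
      and nonneg: "\<forall>u\<in>carrier_vec n. (u @\<^sub>v Z *\<^sub>v u) \<bullet> (H_mat n m \<Phi> Xd X U *\<^sub>v (u @\<^sub>v Z *\<^sub>v u)) \<ge> 0"
    \<comment> \<open>The first \<open>n\<close> rows of \<open>Z\<close> are
      \<open>A\<^sup>T\<close> and the remaining \<open>m\<close> rows are
      \<open>B\<^sup>T\<close>.\<close>
    define A where "A = mat n n (\<lambda>(i, j). Z $$ (j, i))"
    define B where "B = mat n m (\<lambda>(i, j). Z $$ (n + j, i))"
    have AB: "A \<in> carrier_mat n n" "B \<in> carrier_mat n m" by (auto simp: A_def B_def)
    have "Z = A\<^sup>T @\<^sub>r B\<^sup>T"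
      using Z by (intro eq_matI) (auto simp: A_def B_def append_rows_def)
    then have Zu: "Z *\<^sub>v u = A\<^sup>T *\<^sub>v u @\<^sub>v B\<^sup>T *\<^sub>v u" if "u \<in> carrier_vec n" for u
      using that AB by (simp add: mat_vec_simps)
    have dimAB: "dim_vec (A\<^sup>T *\<^sub>v u) = n" "dim_vec (B\<^sup>T *\<^sub>v u) = m" for u
      using AB by auto
    have "\<forall>u\<in>carrier_vec n. noise_form u (A\<^sup>T *\<^sub>v u) (B\<^sup>T *\<^sub>v u) \<ge> 0"
      using nonneg dimAB by (simp add: Zu H_form del: dim_mult_mat_vec)
    from imp[OF AB this] show "\<forall>u\<in>carrier_vec n. (u @\<^sub>v Z *\<^sub>v u) \<bullet> (M *\<^sub>v (u @\<^sub>v Z *\<^sub>v u)) \<ge> 0"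
      using dimAB by (simp add: Zu quadratic del: dim_mult_mat_vec)
  qed
  then obtain \<alpha> where "\<alpha> \<ge> 0" and
    \<alpha>: "\<And>x. x \<in> carrier_vec (n + (n + m)) \<Longrightarrow> x \<bullet> (M *\<^sub>v x) \<ge> \<alpha> * (x \<bullet> (H_mat n m \<Phi> Xd X U *\<^sub>v x))"
    by blast
  have "lyapunov_form \<Psi> S L u w z \<ge> \<alpha> * noise_form u w z"
    if "u \<in> carrier_vec n" "w \<in> carrier_vec n" "z \<in> carrier_vec m" for u w z
    using \<alpha>[of "u @\<^sub>v w @\<^sub>v z"] that by (simp add: quadratic H_form)
  then show ?thesis using \<open>\<alpha> \<ge> 0\<close> by blast
qed

end

text \<open>The substitution \<open>u = P v\<close> is the congruence by \<open>minv P\<close>: it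
  turns \<open>minv P\<close> applied to \<open>u\<close> into \<open>v\<close> and
  \<open>K * minv P\<close> applied to \<open>u\<close> into \<open>K v\<close>.\<close>

lemma lyapunov_nsd_iff:
  assumes P: "P \<in> carrier_mat n n" "pd P" and K: "K \<in> carrier_mat m n"
    and A: "A \<in> carrier_mat n n" and B: "B \<in> carrier_mat n m"
    and R: "R \<in> carrier_mat n n" "R\<^sup>T = R" and Q: "Q \<in> carrier_mat n n" "Q\<^sup>T = Q"
  shows "nsd ((A + B * K)\<^sup>T * P + P * (A + B * K) + R + Q) \<longleftrightarrow>
    (\<forall>u\<in>carrier_vec n. lyapunov_form (R + Q) (minv P) (K * minv P) u (A\<^sup>T *\<^sub>v u) (B\<^sup>T *\<^sub>v u) \<ge> 0)"
proof -
  note inv = pd_minv[OF P]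
  note [simp] = carrier_matD[OF P(1)] carrier_matD[OF K] carrier_matD[OF A] carrier_matD[OF B]
    carrier_matD[OF R(1)] carrier_matD[OF Q(1)] carrier_matD[OF inv(1)]
  define C where "C = A + B * K"
  have [simp]: "dim_row C = n" "dim_col C = n" by (simp_all add: C_def)
  define F where "F = C\<^sup>T * P + P * C + R + Q"
  have F: "F \<in> carrier_mat n n" by (rule carrier_matI) (simp_all add: F_def)
  note [simp] = carrier_matD[OF F]
  have Pcomm: "v \<bullet> (P *\<^sub>v y) = (P *\<^sub>v v) \<bullet> y" if "dim_vec v = n" "dim_vec y = n" for v y
    using scalar_prod_mult_transpose[of P y v] that P(2) by (simp add: pd_def)
  have form: "v \<bullet> (F *\<^sub>v y) = (C *\<^sub>v v) \<bullet> (P *\<^sub>v y) + (P *\<^sub>v v) \<bullet> (C *\<^sub>v y) + v \<bullet> (R *\<^sub>v y) + v \<bullet> (Q *\<^sub>v y)"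
    if "v \<in> carrier_vec n" "y \<in> carrier_vec n" for v y
    using that by (simp add: F_def mat_vec_simps Pcomm[of v])
  have "F\<^sup>T = F"
  proof (rule symmetric_matI[OF F])
    fix x y :: "real vec" assume xy: "x \<in> carrier_vec n" "y \<in> carrier_vec n"
    show "x \<bullet> (F *\<^sub>v y) = y \<bullet> (F *\<^sub>v x)"
      unfolding form[OF xy] form[OF xy(2,1)]
      using scalar_prod_symmetric_mat[OF R(2,1) xy] scalar_prod_symmetric_mat[OF Q(2,1) xy]
        scalar_prod_commute[of "C *\<^sub>v x" "P *\<^sub>v y"] scalar_prod_commute[of "P *\<^sub>v x" "C *\<^sub>v y"]
      by simp
  qed
  then have "nsd F \<longleftrightarrow> (\<forall>v\<in>carrier_vec n. - (v \<bullet> (F *\<^sub>v v)) \<ge> 0)"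
    by (auto simp: nsd_def psd_def transpose_uminus)
  also have "\<dots> \<longleftrightarrow> (\<forall>v\<in>carrier_vec n. lyapunov_form (R + Q) (minv P) (K * minv P)
      (P *\<^sub>v v) (A\<^sup>T *\<^sub>v (P *\<^sub>v v)) (B\<^sup>T *\<^sub>v (P *\<^sub>v v)) \<ge> 0)"
  proof (intro ball_cong refl)
    fix v :: "real vec" assume v: "v \<in> carrier_vec n"
    note [simp] = carrier_vecD[OF v]
    have "- (v \<bullet> (F *\<^sub>v v)) = lyapunov_form (R + Q) (minv P) (K * minv P)
      (P *\<^sub>v v) (A\<^sup>T *\<^sub>v (P *\<^sub>v v)) (B\<^sup>T *\<^sub>v (P *\<^sub>v v))"
      unfolding form[OF v v] lyapunov_form_def
      using scalar_prod_commute[of "P *\<^sub>v v" "C *\<^sub>v v"]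
      by (simp add: mat_vec_simps minv_mult_cancel[OF P v] C_def)
    then show "0 \<le> - (v \<bullet> (F *\<^sub>v v)) \<longleftrightarrow> 0 \<le> lyapunov_form (R + Q) (minv P) (K * minv P)
      (P *\<^sub>v v) (A\<^sup>T *\<^sub>v (P *\<^sub>v v)) (B\<^sup>T *\<^sub>v (P *\<^sub>v v))" by simp
  qed
  \<comment> \<open>Invertibility of \<open>P\<close> makes \<open>P v\<close> range over all
    vectors.\<close>
  also have "\<dots> \<longleftrightarrow> (\<forall>u\<in>carrier_vec n.
      lyapunov_form (R + Q) (minv P) (K * minv P) u (A\<^sup>T *\<^sub>v u) (B\<^sup>T *\<^sub>v u) \<ge> 0)"
    using minv_mult_cancel(1)[OF P] mult_mat_vec_carrier[OF P(1)] mult_mat_vec_carrier[OF inv(1)]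
    by metis
  finally show ?thesis by (simp add: F_def C_def)
qed

section \<open>The block diagonal matrix of the other modes\<close>

lemma pd_smult:
  assumes "pd A" "c > 0"
  shows "pd (c \<cdot>\<^sub>m A)"
proof -
  have "(c \<cdot>\<^sub>m A)\<^sup>T = c \<cdot>\<^sub>m A\<^sup>T" by (rule eq_matI) auto
  then show ?thesis using assms by (auto simp: pd_def smult_mat_mult_vec)
qed

lemma pd_one: "pd (1\<^sub>m n)"
proof -
  have "v \<bullet> v > 0" if v: "v \<in> carrier_vec n" "v \<noteq> 0\<^sub>v n" for v :: "real vec"
  proof -
    obtain i where "i < n" "v $ i \<noteq> 0" using v by (metis eq_vecI carrier_vecD index_zero_vec)
    then show ?thesis using v(1) unfolding scalar_prod_def
      by (intro sum_pos2[of _ i]) (auto simp: zero_less_mult_iff not_less_iff_gr_or_eq)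
  qed
  then show ?thesis by (auto simp: pd_def)
qed

text \<open>\<open>\<Theta>\<close> is the product of \<open>P_minus\<close> and
  \<open>pi_minus\<close> in this order, so its inverse is the product of the inverses in the order
  used by the linear matrix inequality. Positivity of the off-diagonal rates makes it positive
  definite.\<close>

lemma pi_P_minus:
  assumes i: "i < N" and \<pi>: "\<pi> \<in> M_plus N"
    and P: "\<forall>j<N. P j \<in> carrier_mat n n" "\<forall>j<N. pd (P j)"
  defines "\<Theta> \<equiv> diag_block_mat (map (\<lambda>j. \<pi> $$ (j, i) \<cdot>\<^sub>m P j) (filter (\<lambda>j. j \<noteq> i) [0..<N]))"
  shows "\<Theta> \<in> carrier_mat ((N - 1) * n) ((N - 1) * n)" "pd \<Theta>"
    "minv (pi_minus N n \<pi> i) * minv (P_minus N P i) = minv \<Theta>"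
    "x \<in> carrier_vec n \<Longrightarrow> ((ones_col (N - 1) \<otimes>\<^sub>m 1\<^sub>m n) *\<^sub>v x) \<bullet> (\<Theta> *\<^sub>v ((ones_col (N - 1) \<otimes>\<^sub>m 1\<^sub>m n) *\<^sub>v x)) =
      (\<Sum>j\<in>{..<N} - {i}. \<pi> $$ (j, i) * (x \<bullet> (P j *\<^sub>v x)))"
proof -
  define js where "js = filter (\<lambda>j. j \<noteq> i) [0..<N]"
  have dist: "distinct js" and set: "set js = {..<N} - {i}" by (auto simp: js_def)
  \<comment> \<open>The subtraction is exact on natural numbers because
    \<open>i < N\<close>.\<close>
  have len: "length js = N - 1" using distinct_card[OF dist] i by (simp add: set)
  have pos: "\<pi> $$ (j, i) > 0" if "j \<in> set js" for j using that \<pi> i by (auto simp: set M_plus_def)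
  have carP: "P j \<in> carrier_mat n n" and pdP: "pd (P j)" if "j \<in> set js" for j
    using that P by (auto simp: set)
  let ?k = "(N - 1) * n"
  have \<Theta>_def': "\<Theta> = diag_block_mat (map (\<lambda>j. \<pi> $$ (j, i) \<cdot>\<^sub>m P j) js)" by (simp add: \<Theta>_def js_def)
  show \<Theta>: "\<Theta> \<in> carrier_mat ?k ?k"
    unfolding \<Theta>_def' len[symmetric] using carP by (intro diag_block_mat_map_carrier) auto
  show "pd \<Theta>"
    unfolding \<Theta>_def' using carP pdP pos by (intro pd_diag_block_mat[of _ _ n] pd_smult) auto
  have Pm: "P_minus N P i \<in> carrier_mat ?k ?k" "pd (P_minus N P i)"
    unfolding P_minus_def js_def[symmetric] len[symmetric]
    using carP pdP by (auto intro!: diag_block_mat_map_carrier pd_diag_block_mat[of _ _ n])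
  have pm: "pi_minus N n \<pi> i \<in> carrier_mat ?k ?k" "pd (pi_minus N n \<pi> i)"
    unfolding pi_minus_def js_def[symmetric] len[symmetric]
    using pos by (auto intro!: diag_block_mat_map_carrier pd_diag_block_mat[of _ _ n] pd_smult pd_one)
  have prod: "P_minus N P i * pi_minus N n \<pi> i = \<Theta>"
  proof -
    have "P j * (\<pi> $$ (j, i) \<cdot>\<^sub>m 1\<^sub>m n) = \<pi> $$ (j, i) \<cdot>\<^sub>m P j" if "j \<in> set js" for j
      using carP[OF that] by (simp add: mult_smult_distrib[of _ n n _ n])
    then show ?thesis
      unfolding P_minus_def pi_minus_def \<Theta>_def' js_def[symmetric]
      using carP by (subst diag_block_mat_mult[of _ _ n]) (auto cong: map_cong)
  qed
  note iP = pd_minv[OF Pm] and ip = pd_minv[OF pm]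
  have "\<Theta> * (minv (pi_minus N n \<pi> i) * minv (P_minus N P i)) =
      P_minus N P i * (pi_minus N n \<pi> i * minv (pi_minus N n \<pi> i) * minv (P_minus N P i))"
    unfolding prod[symmetric] using Pm pm iP(1) ip(1)
    by (simp add: assoc_mult_mat[of _ ?k ?k _ ?k _ ?k])
  also have "\<dots> = 1\<^sub>m ?k" using iP ip by simp
  finally show "minv (pi_minus N n \<pi> i) * minv (P_minus N P i) = minv \<Theta>"
    using minv_eqI[OF \<Theta>, of "minv (pi_minus N n \<pi> i) * minv (P_minus N P i)"] iP(1) ip(1) by simp
  assume x: "x \<in> carrier_vec n"
  have "((ones_col (N - 1) \<otimes>\<^sub>m 1\<^sub>m n) *\<^sub>v x) \<bullet> (\<Theta> *\<^sub>v ((ones_col (N - 1) \<otimes>\<^sub>m 1\<^sub>m n) *\<^sub>v x)) =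
      (\<Sum>j\<leftarrow>js. x \<bullet> ((\<pi> $$ (j, i) \<cdot>\<^sub>m P j) *\<^sub>v x))"
    unfolding \<Theta>_def' len[symmetric] using carP x by (intro kronecker_ones_quadratic_form) auto
  also have "\<dots> = (\<Sum>j\<in>set js. x \<bullet> ((\<pi> $$ (j, i) \<cdot>\<^sub>m P j) *\<^sub>v x))"
    by (rule sum_list_distinct_conv_sum_set[OF dist])
  also have "\<dots> = (\<Sum>j\<in>{..<N} - {i}. \<pi> $$ (j, i) * (x \<bullet> (P j *\<^sub>v x)))"
    unfolding set[symmetric] using x carrier_matD[OF carP]
    by (intro sum.cong refl) (simp add: mat_vec_simps)
  finally show "((ones_col (N - 1) \<otimes>\<^sub>m 1\<^sub>m n) *\<^sub>v x) \<bullet> (\<Theta> *\<^sub>v ((ones_col (N - 1) \<otimes>\<^sub>m 1\<^sub>m n) *\<^sub>v x)) =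
      (\<Sum>j\<in>{..<N} - {i}. \<pi> $$ (j, i) * (x \<bullet> (P j *\<^sub>v x)))" .
qed

section \<open>The linear matrix inequality of one mode and the equivalence for it\<close>

context noisy_data
begin

text \<open>At a block vector \<open>(a, b, u, w, z)\<close> the form is
  \<open>lyapunov_form\<close> minus \<open>\<alpha>\<close> times \<open>noise_form\<close>, plus
  one completed square in \<open>a\<close> with \<open>Q\<close> and one in \<open>b\<close> with
  \<open>\<Theta>\<close>. The squares are nonnegative and vanish for suitable \<open>a\<close> and
  \<open>b\<close>.\<close>

lemma lmi_psd_iff:
  assumes i: "i < N" and \<pi>: "\<pi> \<in> M_plus N"
    and P: "\<forall>j<N. P j \<in> carrier_mat n n" "\<forall>j<N. pd (P j)"
    and Q: "Q \<in> carrier_mat n n" "pd Q" and L: "L \<in> carrier_mat m n"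
  shows "psd (lmi_mat N n m Q P \<pi> L i -
      \<alpha> \<cdot>\<^sub>m (Gamma_mat N n m T Xd X U * \<Phi> * (Gamma_mat N n m T Xd X U)\<^sup>T)) \<longleftrightarrow>
    (\<forall>u\<in>carrier_vec n. \<forall>w\<in>carrier_vec n. \<forall>z\<in>carrier_vec m.
      lyapunov_form (mat_sum n n (\<lambda>j. \<pi> $$ (j, i) \<cdot>\<^sub>m P j) {..<N} + Q) (minv (P i)) L u w z
        \<ge> \<alpha> * noise_form u w z)"
proof -
  define k where "k = (N - 1) * n"
  define E where "E = ones_col (N - 1) \<otimes>\<^sub>m 1\<^sub>m n"
  define \<Theta> where "\<Theta> = diag_block_mat (map (\<lambda>j. \<pi> $$ (j, i) \<cdot>\<^sub>m P j) (filter (\<lambda>j. j \<noteq> i) [0..<N]))"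
  note \<Theta> = pi_P_minus[OF i \<pi> P, folded \<Theta>_def k_def E_def]
  define S where "S = minv (P i)"
  define \<Gamma> where "\<Gamma> = Gamma_mat N n m T Xd X U"
  define \<Psi> where "\<Psi> = mat_sum n n (\<lambda>j. \<pi> $$ (j, i) \<cdot>\<^sub>m P j) {..<N} + Q"
  define M where "M = lmi_mat N n m Q P \<pi> L i"
  note Pi = P(1)[rule_format, OF i] P(2)[rule_format, OF i]
  note S = pd_minv[OF Pi, folded S_def] and iQ = pd_minv[OF Q] and i\<Theta> = pd_minv[OF \<Theta>(1,2)]
  have [simp]: "dim_row E = k" "dim_col E = n" by (simp_all add: E_def k_def kronecker_def ones_col_def)
  note [simp] = carrier_matD[OF L] carrier_matD[OF S(1)] carrier_matD[OF iQ(1)] carrier_matD[OF i\<Theta>(1)]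
  have [simp]: "dim_row \<Gamma> = n + (k + (n + (n + m)))" "dim_col \<Gamma> = n + T"
    by (simp_all add: \<Gamma>_def k_def)
  have M_eq: "M = block_mat
       [[minv Q,   0\<^sub>m n k, S, 0\<^sub>m n n, 0\<^sub>m n m],
        [0\<^sub>m k n, minv \<Theta>, E * S, 0\<^sub>m k n, 0\<^sub>m k m],
        [S, S * E\<^sup>T, - (\<pi> $$ (i, i)) \<cdot>\<^sub>m S, - S, - L\<^sup>T],
        [0\<^sub>m n n, 0\<^sub>m n k, - S, 0\<^sub>m n n, 0\<^sub>m n m],
        [0\<^sub>m m n, 0\<^sub>m m k, - L, 0\<^sub>m m n, 0\<^sub>m m m]]"
    unfolding M_def lmi_mat_def Let_def k_def[symmetric] E_def[symmetric] S_def[symmetric] \<Theta>(3)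
    by (rule refl)
  have [simp]: "dim_row M = n + (k + (n + (n + m)))" "dim_col M = n + (k + (n + (n + m)))"
    by (simp_all add: M_eq block_mat_def)
  define V where "V = M - \<alpha> \<cdot>\<^sub>m (\<Gamma> * \<Phi> * \<Gamma>\<^sup>T)"
  have V: "V \<in> carrier_mat (n + (k + (n + (n + m)))) (n + (k + (n + (n + m))))"
    by (rule carrier_matI) (simp_all add: V_def)
  have Scomm: "v \<bullet> (S *\<^sub>v y) = (S *\<^sub>v v) \<bullet> y" if "dim_vec v = n" "dim_vec y = n" for v y
    using scalar_prod_mult_transpose[of S y v] that S(4) by simp
  have split: "\<exists>a b u w z. dim_vec a = n \<and> dim_vec b = k \<and> dim_vec u = n \<and> dim_vec w = n \<and> dim_vec z = m \<and>
      x = a @\<^sub>v b @\<^sub>v u @\<^sub>v w @\<^sub>v z"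
    if "x \<in> carrier_vec (n + (k + (n + (n + m))))" for x :: "real vec"
  proof -
    define x1 where "x1 = vec_last x (k + (n + (n + m)))"
    define x2 where "x2 = vec_last x1 (n + (n + m))"
    define x3 where "x3 = vec_last x2 (n + m)"
    have "x = vec_first x n @\<^sub>v vec_first x1 k @\<^sub>v vec_first x2 n @\<^sub>v vec_first x3 n @\<^sub>v vec_last x3 m"
      using that by (simp add: x1_def x2_def x3_def)
    then show ?thesis by (metis dim_vec_first dim_vec_last)
  qed
  \<comment> \<open>The bilinear form is computed, not just the quadratic one, because
    \<open>psd\<close> includes symmetry of the matrix.\<close>
  have bilinear: "(a @\<^sub>v b @\<^sub>v u @\<^sub>v w @\<^sub>v z) \<bullet> (V *\<^sub>v (a' @\<^sub>v b' @\<^sub>v u' @\<^sub>v w' @\<^sub>v z')) =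
      a \<bullet> (minv Q *\<^sub>v a') + a \<bullet> (S *\<^sub>v u') + b \<bullet> (minv \<Theta> *\<^sub>v b') + b \<bullet> (E *\<^sub>v (S *\<^sub>v u'))
      + (S *\<^sub>v u) \<bullet> a' + (E *\<^sub>v (S *\<^sub>v u)) \<bullet> b' - \<pi> $$ (i, i) * (u \<bullet> (S *\<^sub>v u'))
      - (S *\<^sub>v u) \<bullet> w' - (L *\<^sub>v u) \<bullet> z' - w \<bullet> (S *\<^sub>v u') - z \<bullet> (L *\<^sub>v u')
      - \<alpha> * ((u @\<^sub>v residual u w z) \<bullet> (\<Phi> *\<^sub>v (u' @\<^sub>v residual u' w' z')))"
    if d: "dim_vec a = n" "dim_vec b = k" "dim_vec u = n" "dim_vec w = n" "dim_vec z = m"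
      "dim_vec a' = n" "dim_vec b' = k" "dim_vec u' = n" "dim_vec w' = n" "dim_vec z' = m"
    for a b u w z a' b' u' w' z'
  proof -
    let ?x = "a @\<^sub>v b @\<^sub>v u @\<^sub>v w @\<^sub>v z" and ?y = "a' @\<^sub>v b' @\<^sub>v u' @\<^sub>v w' @\<^sub>v z'"
    have "?x \<bullet> (M *\<^sub>v ?y) = a \<bullet> (minv Q *\<^sub>v a') + a \<bullet> (S *\<^sub>v u') + b \<bullet> (minv \<Theta> *\<^sub>v b') + b \<bullet> (E *\<^sub>v (S *\<^sub>v u'))
      + (S *\<^sub>v u) \<bullet> a' + (E *\<^sub>v (S *\<^sub>v u)) \<bullet> b' - \<pi> $$ (i, i) * (u \<bullet> (S *\<^sub>v u'))
      - (S *\<^sub>v u) \<bullet> w' - (L *\<^sub>v u) \<bullet> z' - w \<bullet> (S *\<^sub>v u') - z \<bullet> (L *\<^sub>v u')"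
      using d Scomm[of u a'] Scomm[of u "E\<^sup>T *\<^sub>v b'"] Scomm[of u w']
      by (simp add: M_eq block_mat_def mat_vec_simps)
    moreover have "?x \<bullet> ((\<Gamma> * \<Phi> * \<Gamma>\<^sup>T) *\<^sub>v ?y) =
        (u @\<^sub>v residual u w z) \<bullet> (\<Phi> *\<^sub>v (u' @\<^sub>v residual u' w' z'))"
      using d Gamma_transpose_mult[of a b N u w z] Gamma_transpose_mult[of a' b' N u' w' z']
        scalar_prod_transpose_mult[of \<Gamma> ?x "\<Phi> *\<^sub>v (\<Gamma>\<^sup>T *\<^sub>v ?y)"]
      by (simp add: mat_mult_vec_assoc \<Gamma>_def k_def)
    ultimately show ?thesis using d by (simp add: V_def minus_mat_mult_vec smult_mat_mult_vec scalar_prod_minus_right)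
  qed
  have V_sym: "V\<^sup>T = V"
  proof (rule symmetric_matI[OF V])
    fix x y :: "real vec"
    assume xy: "x \<in> carrier_vec (n + (k + (n + (n + m))))" "y \<in> carrier_vec (n + (k + (n + (n + m))))"
    obtain a b u w z where x: "dim_vec a = n" "dim_vec b = k" "dim_vec u = n" "dim_vec w = n" "dim_vec z = m"
      "x = a @\<^sub>v b @\<^sub>v u @\<^sub>v w @\<^sub>v z" using split[OF xy(1)] by blast
    obtain a' b' u' w' z' where y: "dim_vec a' = n" "dim_vec b' = k" "dim_vec u' = n" "dim_vec w' = n" "dim_vec z' = m"
      "y = a' @\<^sub>v b' @\<^sub>v u' @\<^sub>v w' @\<^sub>v z'" using split[OF xy(2)] by blast
    have "(u @\<^sub>v residual u w z) \<bullet> (\<Phi> *\<^sub>v (u' @\<^sub>v residual u' w' z')) =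
        (u' @\<^sub>v residual u' w' z') \<bullet> (\<Phi> *\<^sub>v (u @\<^sub>v residual u w z))"
      by (rule scalar_prod_symmetric_mat[OF \<Phi>_sym \<Phi>_carrier]) (use x y in \<open>auto intro!: carrier_vecI\<close>)
    moreover have "a \<bullet> (minv Q *\<^sub>v a') = a' \<bullet> (minv Q *\<^sub>v a)"
      by (rule scalar_prod_symmetric_mat[OF iQ(4,1)]) (use x y in \<open>auto intro!: carrier_vecI\<close>)
    moreover have "b \<bullet> (minv \<Theta> *\<^sub>v b') = b' \<bullet> (minv \<Theta> *\<^sub>v b)"
      by (rule scalar_prod_symmetric_mat[OF i\<Theta>(4,1)]) (use x y in \<open>auto intro!: carrier_vecI\<close>)
    moreover have "u \<bullet> (S *\<^sub>v u') = u' \<bullet> (S *\<^sub>v u)"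
      by (rule scalar_prod_symmetric_mat[OF S(4,1)]) (use x y in \<open>auto intro!: carrier_vecI\<close>)
    ultimately show "x \<bullet> (V *\<^sub>v y) = y \<bullet> (V *\<^sub>v x)"
      unfolding x(6) y(6) bilinear[OF x(1-5) y(1-5)] bilinear[OF y(1-5) x(1-5)]
      using x y scalar_prod_commute[of "S *\<^sub>v u" w'] scalar_prod_commute[of "L *\<^sub>v u" z']
        scalar_prod_commute[of "S *\<^sub>v u'" w] scalar_prod_commute[of "L *\<^sub>v u'" z]
        scalar_prod_commute[of "S *\<^sub>v u" a'] scalar_prod_commute[of "S *\<^sub>v u'" a]
        scalar_prod_commute[of "E *\<^sub>v (S *\<^sub>v u)" b'] scalar_prod_commute[of "E *\<^sub>v (S *\<^sub>v u')" b]
      by simp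
  qed
  \<comment> \<open>The summand \<open>j = i\<close> is split off: with \<open>x = S u\<close> one
    has \<open>P i x = u\<close>, so it becomes the form of \<open>S\<close> at \<open>u\<close>,
    matching the middle diagonal block. The other summands form the \<open>\<Theta>\<close>
    term.\<close>
  have \<Psi>_form: "(S *\<^sub>v u) \<bullet> (\<Psi> *\<^sub>v (S *\<^sub>v u)) = \<pi> $$ (i, i) * (u \<bullet> (S *\<^sub>v u)) +
      (E *\<^sub>v (S *\<^sub>v u)) \<bullet> (\<Theta> *\<^sub>v (E *\<^sub>v (S *\<^sub>v u))) + (S *\<^sub>v u) \<bullet> (Q *\<^sub>v (S *\<^sub>v u))"
    if "dim_vec u = n" for u
  proof -
    have u: "u \<in> carrier_vec n" by (rule carrier_vecI[OF that])
    define x where "x = S *\<^sub>v u"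
    have x: "x \<in> carrier_vec n" by (auto simp: x_def intro!: carrier_vecI)
    have Px: "P i *\<^sub>v x = u" unfolding x_def S_def by (rule minv_mult_cancel[OF Pi u])
    have "x \<bullet> (mat_sum n n (\<lambda>j. \<pi> $$ (j, i) \<cdot>\<^sub>m P j) {..<N} *\<^sub>v x) =
        (\<Sum>j<N. x \<bullet> ((\<pi> $$ (j, i) \<cdot>\<^sub>m P j) *\<^sub>v x))"
      using P(1) x by (intro mat_sum_quadratic_form) auto
    also have "\<dots> = (\<Sum>j<N. \<pi> $$ (j, i) * (x \<bullet> (P j *\<^sub>v x)))"
      using x carrier_matD[OF P(1)[rule_format]] by (intro sum.cong refl) (simp add: mat_vec_simps)
    also have "\<dots> = \<pi> $$ (i, i) * (x \<bullet> (P i *\<^sub>v x)) + (\<Sum>j\<in>{..<N} - {i}. \<pi> $$ (j, i) * (x \<bullet> (P j *\<^sub>v x)))"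
      using i by (intro sum.remove) auto
    finally show ?thesis
      using x Q(1) carrier_matD[OF mat_sum_carrier[of n n "\<lambda>j. \<pi> $$ (j, i) \<cdot>\<^sub>m P j" "{..<N}"]]
        scalar_prod_commute[of x u] that
      unfolding x_def[symmetric] \<Psi>_def by (simp add: mat_vec_simps Px \<Theta>(4))
  qed
  have quadratic: "(a @\<^sub>v b @\<^sub>v u @\<^sub>v w @\<^sub>v z) \<bullet> (V *\<^sub>v (a @\<^sub>v b @\<^sub>v u @\<^sub>v w @\<^sub>v z)) =
      (a \<bullet> (minv Q *\<^sub>v a) + 2 * (a \<bullet> (S *\<^sub>v u)) + (S *\<^sub>v u) \<bullet> (Q *\<^sub>v (S *\<^sub>v u))) +
      (b \<bullet> (minv \<Theta> *\<^sub>v b) + 2 * (b \<bullet> (E *\<^sub>v (S *\<^sub>v u))) + (E *\<^sub>v (S *\<^sub>v u)) \<bullet> (\<Theta> *\<^sub>v (E *\<^sub>v (S *\<^sub>v u)))) +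
      (lyapunov_form \<Psi> S L u w z - \<alpha> * noise_form u w z)"
    if d: "dim_vec a = n" "dim_vec b = k" "dim_vec u = n" "dim_vec w = n" "dim_vec z = m" for a b u w z
    unfolding bilinear[OF d d] noise_form_def lyapunov_form_def \<Psi>_form[OF d(3)]
    using d scalar_prod_commute[of "S *\<^sub>v u" w] scalar_prod_commute[of "L *\<^sub>v u" z]
      scalar_prod_commute[of "S *\<^sub>v u" a] scalar_prod_commute[of "E *\<^sub>v (S *\<^sub>v u)" b]
    by simp
  have "psd V \<longleftrightarrow> (\<forall>u\<in>carrier_vec n. \<forall>w\<in>carrier_vec n. \<forall>z\<in>carrier_vec m.
      lyapunov_form \<Psi> S L u w z \<ge> \<alpha> * noise_form u w z)"
  proof
    assume psd: "psd V"
    show "\<forall>u\<in>carrier_vec n. \<forall>w\<in>carrier_vec n. \<forall>z\<in>carrier_vec m.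
      lyapunov_form \<Psi> S L u w z \<ge> \<alpha> * noise_form u w z"
    proof (intro ballI)
      fix u w z :: "real vec" assume uwz: "u \<in> carrier_vec n" "w \<in> carrier_vec n" "z \<in> carrier_vec m"
      define y where "y = E *\<^sub>v (S *\<^sub>v u)"
      \<comment> \<open>These \<open>a\<close> and \<open>b\<close> minimise the form of \<open>V\<close> for fixed \<open>u\<close>, \<open>w\<close>, \<open>z\<close>.\<close>
      define a where "a = - (Q *\<^sub>v (S *\<^sub>v u))"
      define b where "b = - (\<Theta> *\<^sub>v y)"
      have Su: "S *\<^sub>v u \<in> carrier_vec n" and y: "y \<in> carrier_vec k"
        by (auto simp: y_def intro!: carrier_vecI)
      have d: "dim_vec a = n" "dim_vec b = k" "dim_vec u = n" "dim_vec w = n" "dim_vec z = m"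
        using uwz Q \<Theta>(1) by (auto simp: a_def b_def)
      have "a @\<^sub>v b @\<^sub>v u @\<^sub>v w @\<^sub>v z \<in> carrier_vec (n + (k + (n + (n + m))))"
        by (rule carrier_vecI) (simp add: d)
      then have "(a @\<^sub>v b @\<^sub>v u @\<^sub>v w @\<^sub>v z) \<bullet> (V *\<^sub>v (a @\<^sub>v b @\<^sub>v u @\<^sub>v w @\<^sub>v z)) \<ge> 0"
        using psd carrier_matD[OF V] by (simp add: psd_def)
      then show "lyapunov_form \<Psi> S L u w z \<ge> \<alpha> * noise_form u w z"
        unfolding quadratic[OF d]
        using complete_square_minv_zero[OF Q Su] complete_square_minv_zero[OF \<Theta>(1,2) y]
        by (simp add: a_def b_def flip: y_def)
    qed
  next
    assume nonneg: "\<forall>u\<in>carrier_vec n. \<forall>w\<in>carrier_vec n. \<forall>z\<in>carrier_vec m.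
      lyapunov_form \<Psi> S L u w z \<ge> \<alpha> * noise_form u w z"
    have "x \<bullet> (V *\<^sub>v x) \<ge> 0" if x_car: "x \<in> carrier_vec (n + (k + (n + (n + m))))" for x
    proof -
      obtain a b u w z where d: "dim_vec a = n" "dim_vec b = k" "dim_vec u = n" "dim_vec w = n" "dim_vec z = m"
        and x: "x = a @\<^sub>v b @\<^sub>v u @\<^sub>v w @\<^sub>v z" using split[OF x_car] by blast
      have y: "S *\<^sub>v u \<in> carrier_vec n" "E *\<^sub>v (S *\<^sub>v u) \<in> carrier_vec k"
        by (auto intro!: carrier_vecI)
      show ?thesis
        unfolding x quadratic[OF d]
        using complete_square_minv_nonneg[OF Q carrier_vecI[OF d(1)] y(1)]
          complete_square_minv_nonneg[OF \<Theta>(1,2) carrier_vecI[OF d(2)] y(2)]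
          nonneg[rule_format, OF carrier_vecI[OF d(3)] carrier_vecI[OF d(4)] carrier_vecI[OF d(5)]]
        by linarith
    qed
    then show "psd V" using V_sym carrier_matD[OF V] by (simp add: psd_def)
  qed
  then show ?thesis by (simp add: V_def M_def \<Gamma>_def \<Psi>_def S_def)
qed

text \<open>Necessity is the S-procedure. For sufficiency, compatibility makes
  \<open>noise_form\<close> nonnegative on the graph of \<open>(A, B)\<close>, and with
  \<open>\<alpha> \<ge> 0\<close> the multiplier inequality gives the Lyapunov inequality.\<close>

lemma mode_iff:
  assumes i: "i < N" and \<pi>: "\<pi> \<in> M_plus N"
    and P: "\<forall>j<N. P j \<in> carrier_mat n n" "\<forall>j<N. pd (P j)"
    and Q: "Q \<in> carrier_mat n n" "pd Q" and K: "K \<in> carrier_mat m n"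
    and slater: "slater n m (H_mat n m \<Phi> Xd X U)"
  shows "(\<forall>(A, B) \<in> compat_set n m T \<Phi> Xd X U.
      nsd ((A + B * K)\<^sup>T * P i + P i * (A + B * K) + mat_sum n n (\<lambda>j. \<pi> $$ (j, i) \<cdot>\<^sub>m P j) {..<N} + Q)) \<longleftrightarrow>
    (\<exists>\<alpha>\<ge>0. psd (lmi_mat N n m Q P \<pi> (K * minv (P i)) i -
      \<alpha> \<cdot>\<^sub>m (Gamma_mat N n m T Xd X U * \<Phi> * (Gamma_mat N n m T Xd X U)\<^sup>T)))"
proof -
  let ?R = "mat_sum n n (\<lambda>j. \<pi> $$ (j, i) \<cdot>\<^sub>m P j) {..<N}"
  let ?S = "minv (P i)" and ?L = "K * minv (P i)"
  note Pi = P(1)[rule_format, OF i] P(2)[rule_format, OF i]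
  note S = pd_minv[OF Pi]
  have L: "?L \<in> carrier_mat m n" using K S(1) by simp
  have R_sym: "?R\<^sup>T = ?R"
  proof (rule transpose_mat_sum)
    fix j assume "j \<in> {..<N}"
    then show "\<pi> $$ (j, i) \<cdot>\<^sub>m P j \<in> carrier_mat n n" using P(1) by simp
    have "(P j)\<^sup>T = P j" using P(2) \<open>j \<in> {..<N}\<close> by (simp add: pd_def)
    moreover have "(c \<cdot>\<^sub>m P j)\<^sup>T = c \<cdot>\<^sub>m (P j)\<^sup>T" for c by (rule eq_matI) auto
    ultimately show "(\<pi> $$ (j, i) \<cdot>\<^sub>m P j)\<^sup>T = \<pi> $$ (j, i) \<cdot>\<^sub>m P j" by simp
  qed
  have Q_sym: "Q\<^sup>T = Q" using Q by (simp add: pd_def)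
  have \<Psi>: "?R + Q \<in> carrier_mat n n" "(?R + Q)\<^sup>T = ?R + Q"
    using Q(1) R_sym Q_sym by (auto simp: transpose_add[of _ n n])
  note nsd_iff = lyapunov_nsd_iff[OF Pi K _ _ mat_sum_carrier R_sym Q(1) Q_sym]
  show ?thesis
    unfolding lmi_psd_iff[OF i \<pi> P Q L]
  proof
    assume *: "\<forall>(A, B) \<in> compat_set n m T \<Phi> Xd X U.
      nsd ((A + B * K)\<^sup>T * P i + P i * (A + B * K) + ?R + Q)"
    show "\<exists>\<alpha>\<ge>0. \<forall>u\<in>carrier_vec n. \<forall>w\<in>carrier_vec n. \<forall>z\<in>carrier_vec m.
      lyapunov_form (?R + Q) ?S ?L u w z \<ge> \<alpha> * noise_form u w z"
    proof (rule S_procedure[OF slater \<Psi> S(1,4) L])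
      fix A B assume AB: "A \<in> carrier_mat n n" "B \<in> carrier_mat n m"
        and "\<forall>u\<in>carrier_vec n. noise_form u (A\<^sup>T *\<^sub>v u) (B\<^sup>T *\<^sub>v u) \<ge> 0"
      then have "(A, B) \<in> compat_set n m T \<Phi> Xd X U" by (simp add: compat_set_iff)
      with * have "nsd ((A + B * K)\<^sup>T * P i + P i * (A + B * K) + ?R + Q)" by blast
      then show "\<forall>u\<in>carrier_vec n. lyapunov_form (?R + Q) ?S ?L u (A\<^sup>T *\<^sub>v u) (B\<^sup>T *\<^sub>v u) \<ge> 0"
        unfolding nsd_iff[OF AB] .
    qed
  next
    assume "\<exists>\<alpha>\<ge>0. \<forall>u\<in>carrier_vec n. \<forall>w\<in>carrier_vec n. \<forall>z\<in>carrier_vec m.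
      lyapunov_form (?R + Q) ?S ?L u w z \<ge> \<alpha> * noise_form u w z"
    then obtain \<alpha> where "\<alpha> \<ge> 0" and \<alpha>: "\<And>u w z. u \<in> carrier_vec n \<Longrightarrow> w \<in> carrier_vec n \<Longrightarrow>
      z \<in> carrier_vec m \<Longrightarrow> lyapunov_form (?R + Q) ?S ?L u w z \<ge> \<alpha> * noise_form u w z" by blast
    show "\<forall>(A, B) \<in> compat_set n m T \<Phi> Xd X U.
      nsd ((A + B * K)\<^sup>T * P i + P i * (A + B * K) + ?R + Q)"
    proof clarify
      fix A B assume "(A, B) \<in> compat_set n m T \<Phi> Xd X U"
      then have A: "A \<in> carrier_mat n n" and B: "B \<in> carrier_mat n m"
        and g: "\<And>u. u \<in> carrier_vec n \<Longrightarrow> noise_form u (A\<^sup>T *\<^sub>v u) (B\<^sup>T *\<^sub>v u) \<ge> 0"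
        by (auto simp: compat_set_iff)
      show "nsd ((A + B * K)\<^sup>T * P i + P i * (A + B * K) + ?R + Q)"
        unfolding nsd_iff[OF A B]
      proof
        fix u :: "real vec" assume u: "u \<in> carrier_vec n"
        have "0 \<le> \<alpha> * noise_form u (A\<^sup>T *\<^sub>v u) (B\<^sup>T *\<^sub>v u)" using \<open>\<alpha> \<ge> 0\<close> g[OF u] by simp
        also have "\<dots> \<le> lyapunov_form (?R + Q) ?S ?L u (A\<^sup>T *\<^sub>v u) (B\<^sup>T *\<^sub>v u)"
          using u A B by (intro \<alpha>) (auto intro!: carrier_vecI)
        finally show "0 \<le> lyapunov_form (?R + Q) ?S ?L u (A\<^sup>T *\<^sub>v u) (B\<^sup>T *\<^sub>v u)" .
      qed
    qed
  qed
qed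

end

theorem theorem1:
  fixes N n m :: nat and T :: "nat \<Rightarrow> nat"
    and Abar Bbar Wbar X Xd U :: "nat \<Rightarrow> real mat"
    and \<Phi> \<Phi>11 \<Phi>12 \<Phi>22 :: "nat \<Rightarrow> real mat"
    and P K :: "nat \<Rightarrow> real mat" and \<pi> Q :: "real mat"
  assumes Abar: "\<And>i. i < N \<Longrightarrow> Abar i \<in> carrier_mat n n"
    and Bbar: "\<And>i. i < N \<Longrightarrow> Bbar i \<in> carrier_mat n m"
    and X: "\<And>i. i < N \<Longrightarrow> X i \<in> carrier_mat n (T i)"
    and Xd: "\<And>i. i < N \<Longrightarrow> Xd i \<in> carrier_mat n (T i)"
    and U: "\<And>i. i < N \<Longrightarrow> U i \<in> carrier_mat m (T i)"
    and \<Phi>11: "\<And>i. i < N \<Longrightarrow> \<Phi>11 i \<in> carrier_mat n n"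
    and \<Phi>12: "\<And>i. i < N \<Longrightarrow> \<Phi>12 i \<in> carrier_mat n (T i)"
    and \<Phi>22: "\<And>i. i < N \<Longrightarrow> \<Phi>22 i \<in> carrier_mat (T i) (T i)"
    and \<Phi>: "\<And>i. i < N \<Longrightarrow> \<Phi> i = block_mat [[\<Phi>11 i, \<Phi>12 i], [(\<Phi>12 i)\<^sup>T, \<Phi>22 i]]"
    and \<Phi>_sym: "\<And>i. i < N \<Longrightarrow> (\<Phi> i)\<^sup>T = \<Phi> i"
    and \<Phi>22_nd: "\<And>i. i < N \<Longrightarrow> nd (\<Phi>22 i)"
    and Wbar: "\<And>i. i < N \<Longrightarrow> Wbar i \<in> noise_set n (T i) (\<Phi> i)"
    and data: "\<And>i. i < N \<Longrightarrow> Xd i = Abar i * X i + Bbar i * U i + Wbar i"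
    and slater: "\<And>i. i < N \<Longrightarrow> slater n m (H_mat n m (\<Phi> i) (Xd i) (X i) (U i))"
    and P: "\<And>i. i < N \<Longrightarrow> P i \<in> carrier_mat n n"
    and P_pd: "\<And>i. i < N \<Longrightarrow> pd (P i)"
    and K: "\<And>i. i < N \<Longrightarrow> K i \<in> carrier_mat m n"
    and \<pi>: "\<pi> \<in> M_plus N"
    and Q: "Q \<in> carrier_mat n n"
    and Q_pd: "pd Q"
  shows "(\<forall>i<N. \<forall>(A, B) \<in> compat_set n m (T i) (\<Phi> i) (Xd i) (X i) (U i).
            nsd ((A + B * K i)\<^sup>T * P i + P i * (A + B * K i)
                 + mat_sum n n (\<lambda>j. \<pi> $$ (j, i) \<cdot>\<^sub>m P j) {..<N} + Q))
     \<longleftrightarrow> (\<exists>\<alpha> :: nat \<Rightarrow> real. (\<forall>i<N. \<alpha> i \<ge> 0) \<and>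
            (\<forall>i<N. let L = K i * minv (P i);
                       \<Gamma> = Gamma_mat N n m (T i) (Xd i) (X i) (U i)
                   in psd (lmi_mat N n m Q P \<pi> L i - \<alpha> i \<cdot>\<^sub>m (\<Gamma> * \<Phi> i * \<Gamma>\<^sup>T))))"
proof -
  have "(\<forall>i<N. \<forall>(A, B) \<in> compat_set n m (T i) (\<Phi> i) (Xd i) (X i) (U i).
            nsd ((A + B * K i)\<^sup>T * P i + P i * (A + B * K i)
                 + mat_sum n n (\<lambda>j. \<pi> $$ (j, i) \<cdot>\<^sub>m P j) {..<N} + Q)) \<longleftrightarrow>
      (\<forall>i<N. \<exists>\<alpha>\<ge>0. psd (lmi_mat N n m Q P \<pi> (K i * minv (P i)) i -
        \<alpha> \<cdot>\<^sub>m (Gamma_mat N n m (T i) (Xd i) (X i) (U i) * \<Phi> i *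
          (Gamma_mat N n m (T i) (Xd i) (X i) (U i))\<^sup>T)))"
  \<comment> \<open>The modes decouple: each has its own compatibility set and its own scalar, while
    all \<open>P j\<close> are fixed.\<close>
  proof (intro all_cong)
    fix i assume i: "i < N"
    interpret noisy_data n m "T i" "\<Phi> i" "\<Phi>11 i" "\<Phi>12 i" "\<Phi>22 i" "Xd i" "X i" "U i"
      by unfold_locales (use i Xd X U \<Phi>11 \<Phi>12 \<Phi>22 \<Phi> \<Phi>_sym \<Phi>22_nd in auto)
    show "(\<forall>(A, B) \<in> compat_set n m (T i) (\<Phi> i) (Xd i) (X i) (U i).
            nsd ((A + B * K i)\<^sup>T * P i + P i * (A + B * K i)
                 + mat_sum n n (\<lambda>j. \<pi> $$ (j, i) \<cdot>\<^sub>m P j) {..<N} + Q)) \<longleftrightarrow>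
      (\<exists>\<alpha>\<ge>0. psd (lmi_mat N n m Q P \<pi> (K i * minv (P i)) i -
        \<alpha> \<cdot>\<^sub>m (Gamma_mat N n m (T i) (Xd i) (X i) (U i) * \<Phi> i *
          (Gamma_mat N n m (T i) (Xd i) (X i) (U i))\<^sup>T)))"
      by (rule mode_iff[OF i \<pi> _ _ Q Q_pd K[OF i] slater[OF i]]) (use P P_pd in auto)
  qed
  \<comment> \<open>The scalars of the separate modes are collected into one function by choice; its
    values from \<open>N\<close> on are arbitrary.\<close>
  moreover have "(\<forall>i<N. \<exists>a\<ge>0. R i a) \<longleftrightarrow> (\<exists>\<alpha>. (\<forall>i<N. \<alpha> i \<ge> 0) \<and> (\<forall>i<N. R i (\<alpha> i)))"
    for R :: "nat \<Rightarrow> real \<Rightarrow> bool"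
    by metis
  ultimately show ?thesis by (simp only: Let_def)
qed

end
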